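(* Let $X,Y$ be complete metric spaces and $E,F$ nontrivial Banach spaces, and assume that $Y$ is bounded. A map $T:U_*(X,E)\to\operatorname{Lip}(Y,F)$ is biseparating if and only if (1) $X$ and $Y$ are separated metric spaces; and (2) there are a bijection $\psi:Y\to X$ and bijections $\Phi(y,\cdot):E\to F$, $y\in Y$, such that (a) $Tf(y)=\Phi(y,f(\psi(y)))$ for all $f\in U_*(X,E)$ and all $y\in Y$; (b) for any bounded sets $B_1$ in $E$ and $B_2$ in $F$, there are a finite set $Y_0$ in $Y$ and a bounded set $B_3$ in $E$ such that $$\bigcup_{y\notin Y_0}\Phi(y,B_1)\text{ is bounded in }F\quad\text{and}\quad B_2\subseteq\bigcap_{y\notin Y_0}\Phi(y,B_3).$$
   Context: $U_*(X,E)$ is the space of bounded uniformly continuous functions $X\to E$; $\operatorname{Lip}(Y,F)$ is the space of Lipschitz functions $Y\to F$. A metric space $X$ is separated if there is $\delta>0$ with $d(x,x')\ge\delta$ for all distinct $x,x'\in X$. For $B\subseteq E$, $\Phi(y,B)=\{\Phi(y,e):e\in B\}$; unions and intersections over $y\notin Y_0$ run over $y\in Y\setminus Y_0$ (an empty intersection being all of $F$). For a function $f$ let $C(f)=\{x: f(x)\neq 0\}$, and write $f\perp_h g$ if $C(f-h)\cap C(g-h)=\emptyset$. A map $T$ (not assumed linear) between two function spaces is biseparating if it is a bijection and for all $f,g,h$ in its domain: $f\perp_h g\iff Tf\perp_{Th}Tg$. *)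

theory Defs
  imports "HOL-Analysis.Analysis"
begin

text \<open>
  A metric space is the universe of a type of class \<open>metric_space\<close>; a map between function
  spaces is a function on the full function type, of which only the values on the domain
  \<open>A\<close> matter. A separated metric space is one with \<open>uniform_discrete UNIV\<close>.
\<close>

definition Ustar :: "('x::metric_space \<Rightarrow> 'e::real_normed_vector) set" where
  "Ustar = {f. bounded (range f) \<and> uniformly_continuous_on UNIV f}"

definition Lip :: "('y::metric_space \<Rightarrow> 'f::real_normed_vector) set" where
  "Lip = {f. \<exists>L. L-lipschitz_on UNIV f}"

definition carrier_set :: "('a \<Rightarrow> 'b::zero) \<Rightarrow> 'a set" where
  "carrier_set f = {x. f x \<noteq> 0}"

text \<open>\<open>perp h f g\<close> is the relation $f \perp_h g$.\<close>

definition perp :: "('a \<Rightarrow> 'b::ab_group_add) \<Rightarrow> ('a \<Rightarrow> 'b) \<Rightarrow> ('a \<Rightarrow> 'b) \<Rightarrow> bool" where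
  "perp h f g \<longleftrightarrow> carrier_set (\<lambda>x. f x - h x) \<inter> carrier_set (\<lambda>x. g x - h x) = {}"

definition biseparating ::
  "('x \<Rightarrow> 'e::ab_group_add) set \<Rightarrow> ('y \<Rightarrow> 'f::ab_group_add) set \<Rightarrow>
    (('x \<Rightarrow> 'e) \<Rightarrow> ('y \<Rightarrow> 'f)) \<Rightarrow> bool" where
  "biseparating A B T \<longleftrightarrow> bij_betw T A B \<and>
    (\<forall>f\<in>A. \<forall>g\<in>A. \<forall>h\<in>A. perp h f g \<longleftrightarrow> perp (T h) (T f) (T g))"

end

theory Submission
  imports Defs "HOL-Library.Ramsey"
begin

text \<open>
  The construction of $\psi$ uses the two function spaces only through properties collected in the
  locale \<open>fun_space\<close>: the members are bounded and uniformly continuous, a bounded Lipschitz scalar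
  function times a vector may be added, two members may be glued along a Lipschitz cutoff, and two
  members that agree at \<open>p\<close> may be glued along a cutoff that oscillates near \<open>p\<close>. Both $U_*(X,E)$ and $\mathrm{Lip}(Y,F)$, for bounded $Y$,
  have these properties, so what follows for $T$ applies to $T^{-1}$ too.
  
  \<^bold>\<open>The homeomorphism.\<close> Fix \<open>h\<close> and perturb \<open>T h\<close> by a bump near \<open>y\<close>; the pulled back function
  differs from \<open>h\<close> on a nonempty open set, and since $T$ preserves $\perp_h$, any \<open>f\<close> that agrees
  with \<open>h\<close> near a point \<open>x\<close> of this set has \<open>T f = T h\<close> somewhere near \<open>y\<close>. Such an \<open>x\<close> is called
  near \<open>y\<close> (\<open>near\<close>). If points near \<open>y\<^sub>n\<close>, for two functions \<open>h\<close> and \<open>h'\<close> with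
  \<open>T h\<close> and \<open>T h'\<close> far apart, stayed away from each other, then Efremovich's lemma would let one glue
  \<open>h\<close> and \<open>h'\<close> along subsequences, and the image of the glued function would not be uniformly
  continuous. Hence near points cluster, uniformly in \<open>y\<close> (\<open>near_close\<close>), and completeness gives a
  uniformly continuous $\psi : Y \to X$ (\<open>tracking\<close>). If \<open>f\<close> and \<open>g\<close> agree at \<open>\<psi> y\<close>, a function that
  oscillates between them at \<open>\<psi> y\<close> forces \<open>T f y = T g y\<close> (\<open>pointwise_dependence\<close>). Applying this
  to $T^{-1}$ as well yields a uniform homeomorphism and the representation
  $Tf(y)=\Phi(y,f(\psi(y)))$ with $\Phi(y,e) = T(e)(y)$, $e$ also denoting the constant function.
  
  \<^bold>\<open>Separatedness.\<close> If $Y$ is not separated there are pairs $y_n \ne y_n'$ at distance $d_n \to 0$,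
  each $y_n$ being isolated from all other points of the two sequences. For each \<open>c\<close> a function $g_c$
  on $X$ is obtained whose image exceeds that of $0$ by about $c\,d_n$ at $y_n$ and by nothing at
  $y_n'$. As $g_c$ is uniformly continuous and vanishes at $\psi(y_n')$, it is tiny at
  $\psi(y_n)$ for large \<open>n\<close>. A single function of $U_*(X,E)$ interpolates the values of $g_c$ at one
  such point for every \<open>c\<close>, and its image has unbounded difference quotients
  (\<open>uniform_discrete_codomain\<close>). So $Y$ is separated, and so is the uniformly
  homeomorphic space $X$.
  
  \<^bold>\<open>Condition (b).\<close> On these separated spaces both function spaces consist of all bounded
  functions, and (b) says exactly that $s \mapsto \Phi(\cdot, s(\cdot))$ and its inverse preserve
  boundedness: a family that is unbounded off every finite set has a selection with unbounded
  image (\<open>bounded_off_finite\<close>). The converse implication is a direct verification.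
\<close>

section \<open>Sequences in metric spaces\<close>

text \<open>
  Efremovich's lemma. Colour a pair \<open>m < n\<close> by which of \<open>dist (x m) (x' n)\<close> and \<open>dist (x n) (x' m)\<close>
  is below \<open>e/4\<close>. By Ramsey's theorem there is an infinite monochromatic set. If one of these
  distances were always small on it, three indices would suffice to connect \<open>x b\<close> to \<open>x' b\<close> by three
  steps shorter than \<open>e/4\<close>.
\<close>

lemma efremovich:
  fixes x x' :: "nat \<Rightarrow> 'a::metric_space"
  assumes e: "e > 0" and far: "\<And>n. dist (x n) (x' n) \<ge> e"
  shows "\<exists>N. infinite N \<and> (\<forall>m\<in>N. \<forall>n\<in>N. dist (x m) (x' n) \<ge> e/4)"
proof -
  define up where "up m n \<longleftrightarrow> dist (x m) (x' n) < e/4" for m n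
  define c :: "nat set \<Rightarrow> nat" where
    "c S = (if up (Min S) (Max S) then 0 else if up (Max S) (Min S) then 1 else 2)" for S
  obtain N t where N: "infinite N" "t < 3" "\<And>m n. m \<in> N \<Longrightarrow> n \<in> N \<Longrightarrow> m \<noteq> n \<Longrightarrow> c {m,n} = t"
  proof -
    have "\<exists>N t. N \<subseteq> UNIV \<and> infinite N \<and> t < 3 \<and> (\<forall>m\<in>N. \<forall>n\<in>N. m \<noteq> n \<longrightarrow> c {m, n} = t)"
      by (rule Ramsey2) (auto simp: c_def)
    then show ?thesis using that by blast
  qed
  have c_eq: "(t = 0 \<longrightarrow> up m n) \<and> (t = 1 \<longrightarrow> up n m) \<and> (t = 2 \<longrightarrow> \<not> up m n \<and> \<not> up n m)"
    if "m \<in> N" "n \<in> N" "m < n" for m n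
  proof -
    have Min: "Min {m, n} = m" using that(3) by simp
    have Max: "Max {m, n} = n" using that(3) by simp
    have "c {m, n} = t" by (rule N(3)[OF that(1,2)]) (use that(3) in simp)
    then have "(if up m n then 0 else if up n m then 1 else 2) = t" by (simp only: c_def Min Max)
    then show ?thesis by (cases "up m n"; cases "up n m") auto
  qed
  obtain a where a: "a \<in> N" using N(1) by (metis finite.emptyI ex_in_conv)
  obtain b where b: "b \<in> N" "a < b" using N(1) by (meson infinite_nat_iff_unbounded)
  obtain d where d: "d \<in> N" "b < d" using N(1) by (meson infinite_nat_iff_unbounded)
  have tri: "dist (x b) (x' b) \<le> dist (x b) q + dist q p + dist p (x' b)" for q p
    using dist_triangle[of "x b" "x' b" q] dist_triangle[of q "x' b" p] by linarith
  have "t \<noteq> 0"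
  proof
    assume "t = 0"
    then have "up a b" "up a d" "up b d"
      using c_eq[of a b] c_eq[of a d] c_eq[of b d] a b d less_trans by blast+
    then show False
      unfolding up_def using tri[of "x' d" "x a"] far[of b] e
      by (simp add: dist_commute)
  qed
  moreover have "t \<noteq> 1"
  proof
    assume "t = 1"
    then have "up b a" "up d a" "up d b"
      using c_eq[of a b] c_eq[of a d] c_eq[of b d] a b d less_trans by blast+
    then show False
      unfolding up_def using tri[of "x' a" "x d"] far[of b] e
      by (simp add: dist_commute)
  qed
  ultimately have "t = 2" using N(2) by linarith
  have "dist (x m) (x' n) \<ge> e/4" if mn: "m \<in> N" "n \<in> N" for m n
  proof (cases m n rule: linorder_cases)
    case less
    then show ?thesis using c_eq[OF mn] \<open>t = 2\<close> by (simp add: up_def not_less)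
  next
    case equal
    then show ?thesis using far[of n] e by simp
  next
    case greater
    then show ?thesis using c_eq[OF mn(2,1)] \<open>t = 2\<close> by (simp add: up_def not_less)
  qed
  then show ?thesis using N(1) by blast
qed

text \<open>
  The distances to \<open>p\<close> are made to halve at each step, so that annuli around \<open>p\<close> through the points
  are well separated in proportion to their radius.
\<close>

lemma fast_sequence:
  fixes p :: "'a::metric_space"
  assumes "\<And>n e. e > 0 \<Longrightarrow> \<exists>z. Q n z \<and> z \<noteq> p \<and> dist z p < e"
  shows "\<exists>w :: nat \<Rightarrow> 'a. (\<forall>n. Q n (w n) \<and> w n \<noteq> p \<and> dist (w n) p < (1/2)^n) \<and>
    (\<forall>m n. m < n \<longrightarrow> dist (w n) p \<le> dist (w m) p / 2)"
proof -
  have "\<exists>w. \<forall>n. (Q n (w n) \<and> w n \<noteq> p \<and> dist (w n) p < (1/2)^n) \<and>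
      dist (w (Suc n)) p \<le> dist (w n) p / 2"
  proof (rule dependent_nat_choice)
    show "\<exists>z. Q 0 z \<and> z \<noteq> p \<and> dist z p < (1/2)^0"
      using assms[of 1 0] by simp
    fix z n assume "Q n z \<and> z \<noteq> p \<and> dist z p < (1/2)^n"
    then show "\<exists>y. (Q (Suc n) y \<and> y \<noteq> p \<and> dist y p < (1/2)^(Suc n)) \<and> dist y p \<le> dist z p / 2"
      using assms[of "min (dist z p / 2) ((1/2)^Suc n)" "Suc n"]
      by (auto intro: less_imp_le)
  qed
  then obtain w where w: "\<And>n. Q n (w n) \<and> w n \<noteq> p \<and> dist (w n) p < (1/2)^n"
    "\<And>n. dist (w (Suc n)) p \<le> dist (w n) p / 2" by blast
  have "dist (w n) p \<le> dist (w m) p / 2" if "m < n" for m n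
    using that
  proof (induction n)
    case (Suc n)
    show ?case
    proof (cases "m = n")
      case False
      then show ?thesis using Suc w(2)[of n] zero_le_dist[of "w n" p] by (simp del: zero_le_dist)
    qed (use w(2) in auto)
  qed simp
  then show ?thesis using w(1) by blast
qed

text \<open>
  A cutoff that takes the values 0 and 1 on balls arbitrarily close to \<open>p\<close>, but whose Lipschitz
  constant at distance \<open>t\<close> from \<open>p\<close> is only of order \<open>1/t\<close>. Multiplied by a function that vanishes at \<open>p\<close>
  to first order it stays Lipschitz. It is built from the quotient by \<open>t\<close> of the
  distance from \<open>t\<close> to the set of the radii with even index: this quotient is scale invariant, vanishes
  at those radii and is at least 1/2 at the radii with odd index.
\<close>

lemma oscillating_cutoff:
  fixes p :: "'a::metric_space" and w :: "nat \<Rightarrow> 'a"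
  assumes w: "\<And>n. w n \<noteq> p" "\<And>n. dist (w n) p < (1/2)^n"
    and half: "\<And>m n. m < n \<Longrightarrow> dist (w n) p \<le> dist (w m) p / 2"
  shows "\<exists>s :: 'a \<Rightarrow> real. (\<forall>z. s z \<in> {0..1}) \<and>
    (\<forall>x z. dist z p * \<bar>s x - s z\<bar> \<le> 8 * dist x z) \<and>
    (\<forall>n. \<exists>r>0. \<forall>z\<in>ball (w n) r. s z = (if even n then 0 else 1))"
proof -
  define R where "R = range (\<lambda>n. dist (w (2*n)) p)"
  define a where "a z = infdist (dist z p) R" for z
  define m where "m z = a z / dist z p" for z
  \<comment> \<open>The slope and the offset leave room for an error below 1/8 in \<open>m\<close>: values below 1/8 are sent to 0,
    values above 3/8 to 1.\<close>
  define s where "s z = max 0 (min 1 (4 * m z - 1/2))" for z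
  have a0: "0 \<le> a z" for z
    by (simp add: a_def infdist_nonneg)
  have a_le: "a z \<le> dist z p" for z
  proof (rule field_le_epsilon)
    fix e :: real assume "e > 0"
    then obtain n where n: "(1/2::real)^n < e" using real_arch_pow_inv[of e "1/2"] by auto
    have "a z \<le> dist (dist z p) (dist (w (2*n)) p)"
      unfolding a_def by (rule infdist_le) (auto simp: R_def)
    also have "\<dots> \<le> dist z p + dist (w (2*n)) p"
      unfolding dist_real_def by (smt (verit) zero_le_dist)
    also have "dist (w (2*n)) p < e"
    proof -
      have "(1/2::real) ^ (2*n) \<le> (1/2) ^ n" by (rule power_decreasing) auto
      then show ?thesis using w(2)[of "2*n"] n by linarith
    qed
    finally show "a z \<le> dist z p + e" by simp
  qed
  have a_lip: "\<bar>a x - a z\<bar> \<le> dist x z" for x z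
    using infdist_triangle_abs[of "dist x p" R "dist z p"] dist_triangle[of x p z] dist_triangle[of z p x]
    by (auto simp: a_def dist_real_def dist_commute abs_le_iff)
  have m_lip: "dist z p * \<bar>m x - m z\<bar> \<le> 2 * dist x z" for x z
  proof (cases "x = p \<or> z = p")
    case True
    then show ?thesis using a_le[of z] a0[of z] by (auto simp: m_def dist_commute)
  next
    case False
    let ?r = "dist x p" and ?t = "dist z p"
    have pos: "?r > 0" "?t > 0" using False by auto
    have "?t * \<bar>m x - m z\<bar> = \<bar>a x / ?r * (?t - ?r) + (a x - a z)\<bar>"
    proof -
      have "?t * \<bar>m x - m z\<bar> = \<bar>?t * (m x - m z)\<bar>" using pos by (simp add: abs_mult)
      also have "?t * (m x - m z) = a x / ?r * (?t - ?r) + (a x - a z)"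
        using pos by (simp add: m_def field_simps)
      finally show ?thesis .
    qed
    also have "\<dots> \<le> \<bar>a x / ?r * (?t - ?r)\<bar> + \<bar>a x - a z\<bar>" by linarith
    also have "\<bar>a x / ?r * (?t - ?r)\<bar> \<le> 1 * \<bar>?t - ?r\<bar>"
      unfolding abs_mult using a_le[of x] a0[of x] pos by (intro mult_right_mono) auto
    also have "\<bar>?t - ?r\<bar> \<le> dist x z"
      using dist_triangle[of x p z] dist_triangle[of z p x] by (auto simp: dist_commute abs_le_iff)
    finally show ?thesis using a_lip[of x z] by linarith
  qed
  have s_m: "\<bar>s x - s z\<bar> \<le> 4 * \<bar>m x - m z\<bar>" for x z
    unfolding s_def by (auto simp: max_def min_def abs_if)
  have near: "\<bar>m z - m (w n)\<bar> < 1/8" if "z \<in> ball (w n) (dist (w n) p / 16)" for z n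
  proof -
    have "dist (w n) p * \<bar>m z - m (w n)\<bar> \<le> 2 * dist z (w n)" by (rule m_lip)
    also have "\<dots> < dist (w n) p * (1/8)" using that by (simp add: dist_commute)
    finally show ?thesis using w(1)[of n] by (simp add: mult_less_cancel_left_pos)
  qed
  have even: "m (w n) = 0" if "even n" for n
    using that by (auto simp: m_def a_def R_def elim!: evenE)
  have odd: "m (w n) \<ge> 1/2" if "odd n" for n
  proof -
    have "dist (w n) p / 2 \<le> dist (dist (w n) p) (dist (w (2*k)) p)" for k
    proof (cases "n < 2*k")
      case True
      then have "dist (w n) p / 2 \<le> dist (w n) p - dist (w (2*k)) p" using half[of n "2*k"] by linarith
      then show ?thesis unfolding dist_real_def by linarith
    next
      case False
      then have "2*k < n" using that by (metis dvd_triv_left linorder_neqE_nat)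
      then have "dist (w n) p / 2 \<le> dist (w (2*k)) p - dist (w n) p"
        using half[of "2*k" n] zero_le_dist[of "w n" p] by linarith
      then show ?thesis unfolding dist_real_def by linarith
    qed
    moreover have range_ne: "range (\<lambda>n. dist (w (2*n)) p) \<noteq> {}" by blast
    ultimately have "dist (w n) p / 2 \<le> a (w n)"
      unfolding a_def R_def infdist_notempty[OF range_ne] by (intro cINF_greatest) auto
    then show ?thesis using w(1)[of n] by (simp add: m_def field_simps)
  qed
  show ?thesis
  proof (rule exI[of _ s], intro conjI allI)
    fix z x :: 'a and n
    show "s z \<in> {0..1}" by (auto simp: s_def)
    have "dist z p * \<bar>s x - s z\<bar> \<le> dist z p * (4 * \<bar>m x - m z\<bar>)"
      by (rule mult_left_mono[OF s_m]) simp
    then show "dist z p * \<bar>s x - s z\<bar> \<le> 8 * dist x z" using m_lip[of z x] by linarith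
    show "\<exists>r>0. \<forall>z\<in>ball (w n) r. s z = (if even n then 0 else 1)"
    proof (intro exI conjI ballI)
      show "dist (w n) p / 16 > 0" using w(1) by simp
      fix z assume z: "z \<in> ball (w n) (dist (w n) p / 16)"
      show "s z = (if even n then 0 else 1)"
      proof (cases "even n")
        case True
        then show ?thesis using near[OF z] even[OF True] by (simp add: s_def)
      next
        case False
        then have "4 * m z - 1/2 \<ge> 1" using near[OF z] odd[OF False] by linarith
        then show ?thesis using False by (simp add: s_def)
      qed
    qed
  qed
qed

text \<open>
  The scale at which \<open>y n\<close> is isolated from all other points in play is proportional to the distance of
  its partner \<open>y' n\<close>. Around a nonisolated point, take that point as the common partner. If all points are
  isolated, take an almost nearest neighbour as partner; then only coincidences have to be avoided,
  which is achieved by letting the distances decrease quickly.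
\<close>

lemma non_uniform_discrete_pairs:
  assumes "\<not> uniform_discrete (UNIV :: 'a::metric_space set)"
  shows "\<exists>y y' :: nat \<Rightarrow> 'a. (\<forall>n. 0 < dist (y n) (y' n)) \<and> (\<forall>n. dist (y n) (y' n) < (1/2)^n) \<and>
    (\<forall>m n. m \<noteq> n \<longrightarrow> dist (y n) (y' n) / 2 \<le> dist (y n) (y m)) \<and>
    (\<forall>m n. dist (y n) (y' n) / 2 \<le> dist (y n) (y' m))"
proof (cases "\<exists>p::'a. \<forall>e>0. \<exists>z. z \<noteq> p \<and> dist z p < e")
  case True
  then obtain p :: 'a where p: "\<And>e. e > 0 \<Longrightarrow> \<exists>z. z \<noteq> p \<and> dist z p < e" by blast
  obtain w where w: "\<And>n. w n \<noteq> p" "\<And>n. dist (w n) p < (1/2)^n"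
    and half: "\<And>m n. m < n \<Longrightarrow> dist (w n) p \<le> dist (w m) p / 2"
    using fast_sequence[of "\<lambda>_ _. True" p] p by blast
  have apart: "dist (w n) p / 2 \<le> dist (w n) (w m)" if "m \<noteq> n" for m n
    using that half[of m n] half[of n m] dist_triangle[of "w n" p "w m"] dist_triangle[of "w m" p "w n"]
      zero_le_dist[of "w n" p]
    by (cases m n rule: linorder_cases) (auto simp: dist_commute simp del: zero_le_dist)
  show ?thesis
  proof (rule exI[of _ w], rule exI[of _ "\<lambda>_. p"], intro conjI allI impI)
    fix m n :: nat
    show "0 < dist (w n) p" using w(1) by simp
    show "dist (w n) p < (1/2) ^ n" by (rule w(2))
    show "dist (w n) p / 2 \<le> dist (w n) p" using zero_le_dist[of "w n" p] by linarith
    show "dist (w n) p / 2 \<le> dist (w n) (w m)" if "m \<noteq> n" by (rule apart[OF that])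
  qed
next
  case False
  define gap where "gap y = infdist y (- {y})" for y :: 'a
  obtain a b :: 'a where ab: "a \<noteq> b"
    using assms unfolding uniform_discrete_def by (metis zero_less_one)
  have ne: "- {y} \<noteq> {}" for y :: 'a using ab by (cases "y = a") auto
  have gap_pos: "gap y > 0" for y
  proof -
    obtain e where e: "e > 0" "\<And>z. z \<noteq> y \<Longrightarrow> e \<le> dist z y" using False by (meson not_less)
    have "e \<le> gap y" unfolding gap_def infdist_notempty[OF ne]
      using e(2) ne by (intro cINF_greatest) (auto simp: dist_commute)
    then show ?thesis using e(1) by linarith
  qed
  have gap_le: "gap y \<le> dist y z" if "z \<noteq> y" for y z
    unfolding gap_def using that by (intro infdist_le) auto
  have "\<exists>z. z \<noteq> y \<and> dist y z < 2 * gap y" for y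
  proof -
    have "(INF z\<in>- {y}. dist y z) < 2 * gap y"
      using gap_pos[of y] by (simp add: gap_def infdist_notempty[OF ne])
    then obtain z where "z \<in> - {y}" "dist y z < 2 * gap y"
      using cINF_less_iff[of "- {y}" "dist y"] ne by (metis bdd_below_image_dist)
    then show ?thesis by blast
  qed
  then obtain nb where nb: "\<And>y. nb y \<noteq> y" "\<And>y. dist y (nb y) < 2 * gap y" by metis
  have small: "\<exists>y. dist y (nb y) < e" if "e > 0" for e
  proof -
    obtain y z :: 'a where yz: "dist y z < e/2" "y \<noteq> z"
      using assms \<open>e > 0\<close> unfolding uniform_discrete_def by (metis half_gt_zero)
    then show ?thesis using gap_le[of z y] nb(2)[of y] by (intro exI[of _ y]) auto
  qed
  have "\<exists>y. \<forall>n. dist (y n) (nb (y n)) < (1/2)^n \<and>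
      dist (y (Suc n)) (nb (y (Suc n))) < min (gap (y n)) (gap (nb (y n))) / 2"
  proof (rule dependent_nat_choice)
    show "\<exists>y. dist y (nb y) < (1/2)^0" using small[of 1] by simp
    fix z :: 'a and n :: nat
    show "\<exists>y. dist y (nb y) < (1/2)^Suc n \<and> dist y (nb y) < min (gap z) (gap (nb z)) / 2"
      using small[of "min ((1/2)^Suc n) (min (gap z) (gap (nb z)) / 2)"] gap_pos[of z] gap_pos[of "nb z"]
      by auto
  qed
  then obtain y where y: "\<And>n. dist (y n) (nb (y n)) < (1/2)^n"
    and step: "\<And>n. dist (y (Suc n)) (nb (y (Suc n))) < min (gap (y n)) (gap (nb (y n))) / 2" by blast
  let ?d = "\<lambda>n. dist (y n) (nb (y n))"
  \<comment> \<open>A pair at distance below the isolation radius of a point cannot involve that point.\<close>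
  have le_gap: "?d n < min (gap (y m)) (gap (nb (y m))) / 2" if "m < n" for m n
    using that
  proof (induction n)
    case (Suc n)
    have "?d (Suc n) < ?d n"
      using step[of n] gap_le[of "nb (y n)" "y n"] nb(1)[of "y n"] gap_pos[of "y n"] by auto
    then show ?case using Suc step[of m] by (cases "m = n") auto
  qed simp
  have y_inj: "y m \<noteq> y n" if "m < n" for m n
    using le_gap[OF that] gap_le[of "nb (y n)" "y n"] nb(1)[of "y n"] gap_pos[of "y n"] by auto
  have y_nb: "nb (y m) \<noteq> y n" for m n
  proof (cases m n rule: linorder_cases)
    case less
    then show ?thesis using le_gap[OF less] gap_le[of "nb (y n)" "y n"] nb(1)[of "y n"] gap_pos[of "y n"]
      by auto
  next
    case greater
    then show ?thesis
      using le_gap[OF greater] gap_le[of "y m" "nb (y m)"] nb(1)[of "y m"] gap_pos[of "y n"]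
      by (auto simp: dist_commute)
  qed (use nb(1) in auto)
  have far: "?d n / 2 \<le> dist (y n) z" if "z \<noteq> y n" for n z
    using gap_le[OF that] nb(2)[of "y n"] by linarith
  show ?thesis
  proof (rule exI[of _ y], rule exI[of _ "\<lambda>n. nb (y n)"], intro conjI allI impI)
    fix m n :: nat
    show "0 < ?d n" using nb(1)[of "y n"] by auto
    show "?d n < (1/2)^n" by (rule y)
    show "?d n / 2 \<le> dist (y n) (nb (y m))" by (rule far) (rule y_nb)
    show "?d n / 2 \<le> dist (y n) (y m)" if "m \<noteq> n"
      by (rule far) (use that y_inj in \<open>metis linorder_neqE_nat\<close>)
  qed
qed

section \<open>Function spaces with enough members\<close>

lemma norm_diff_scaleR_le:
  fixes u v :: "'b::real_normed_vector"
  assumes "\<bar>s\<bar> \<le> 1"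
  shows "norm (s *\<^sub>R u - t *\<^sub>R v) \<le> norm (u - v) + \<bar>s - t\<bar> * norm v"
proof -
  have "s *\<^sub>R u - t *\<^sub>R v = s *\<^sub>R (u - v) + (s - t) *\<^sub>R v"
    by (simp add: algebra_simps)
  also have "norm \<dots> \<le> \<bar>s\<bar> * norm (u - v) + \<bar>s - t\<bar> * norm v"
    by (metis norm_scaleR norm_triangle_ineq)
  also have "\<bar>s\<bar> * norm (u - v) \<le> 1 * norm (u - v)"
    using assms by (rule mult_right_mono) simp
  finally show ?thesis by simp
qed

text \<open>
  The closure properties that the argument uses. In \<open>blend_at\<close> the cutoff \<open>s\<close> may be discontinuous
  at \<open>p\<close>; the product with \<open>g - f\<close> is still well behaved because the latter vanishes there.
\<close>

locale fun_space =
  fixes A :: "('a::metric_space \<Rightarrow> 'b::real_normed_vector) set"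
  assumes nontrivial: "\<exists>u::'b. u \<noteq> 0"
    and zero: "(\<lambda>_. 0) \<in> A"
    and bdd: "f \<in> A \<Longrightarrow> bounded (range f)"
    and ucont: "f \<in> A \<Longrightarrow> uniformly_continuous_on UNIV f"
    and add_scalar: "\<lbrakk>f \<in> A; L-lipschitz_on UNIV s; bounded (range s)\<rbrakk> \<Longrightarrow>
      (\<lambda>x. f x + (s x :: real) *\<^sub>R c) \<in> A"
    and blend: "\<lbrakk>f \<in> A; g \<in> A; L-lipschitz_on UNIV s; \<And>x. s x \<in> {0..1}\<rbrakk> \<Longrightarrow>
      (\<lambda>x. f x + (s x :: real) *\<^sub>R (g x - f x)) \<in> A"
    and blend_at: "\<lbrakk>f \<in> A; g \<in> A; f p = g p; \<And>x. s x \<in> {0..1};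
        \<And>x z. dist z p * \<bar>s x - s z\<bar> \<le> C * dist x z\<rbrakk> \<Longrightarrow>
      (\<lambda>x. f x + (s x :: real) *\<^sub>R (g x - f x)) \<in> A"
begin

lemma const: "(\<lambda>_. c) \<in> A"
  using add_scalar[OF zero, of 0 "\<lambda>_. 1" c] by (simp add: lipschitz_on_def)

lemma translate: "f \<in> A \<Longrightarrow> (\<lambda>x. f x + c) \<in> A"
  using add_scalar[of f 0 "\<lambda>_. 1" c] by (simp add: lipschitz_on_def)

lemma cont: "f \<in> A \<Longrightarrow> continuous_on UNIV f"
  using ucont uniformly_continuous_imp_continuous by blast

text \<open>
  These are the functions whose carrier relative to \<open>f\<close> is a prescribed ball; through them
  the relation $\perp_f$ detects closeness of points.
\<close>

lemma bump: "f \<in> A \<Longrightarrow> (\<lambda>x. f x + max 0 (r - dist x p) *\<^sub>R c) \<in> A"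
proof (rule add_scalar[where L = 1])
  show "1-lipschitz_on UNIV (\<lambda>x. max 0 (r - dist x p))"
  proof (rule lipschitz_onI)
    fix x y show "dist (max 0 (r - dist x p)) (max 0 (r - dist y p)) \<le> 1 * dist x y"
      using dist_triangle[of x p y] dist_triangle[of y p x]
      unfolding dist_real_def dist_commute[of y x] by linarith
  qed simp
  have "\<bar>max 0 (r - dist x p)\<bar> \<le> \<bar>r\<bar>" for x
    using zero_le_dist[of x p] by linarith
  then show "bounded (range (\<lambda>x. max 0 (r - dist x p)))"
    unfolding bounded_iff real_norm_def by blast
qed

lemma separates:
  assumes "p \<noteq> q"
  shows "\<exists>f\<in>A. f p \<noteq> 0 \<and> f q = 0"
proof -
  obtain u :: 'b where "u \<noteq> 0" using nontrivial by blast
  then show ?thesis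
    using assms
    by (intro bexI[OF _ bump[OF zero, of "dist p q" p u]]) (auto simp: dist_commute)
qed

text \<open>
  The cutoff is a piecewise linear function of the distance to \<open>P\<close>, rising from 0 to 1 between the
  distances \<open>e/4\<close> and \<open>3*e/4\<close>.
\<close>

lemma glue:
  assumes f: "f \<in> A" "g \<in> A" and e: "e > 0" and far: "\<And>p q. p \<in> P \<Longrightarrow> q \<in> Q \<Longrightarrow> e \<le> dist p q"
    and ne: "P \<noteq> {}"
  shows "\<exists>k\<in>A. (\<forall>p\<in>P. \<forall>x\<in>ball p (e/4). k x = f x) \<and> (\<forall>q\<in>Q. \<forall>x\<in>ball q (e/4). k x = g x)"
proof -
  define s where "s x = max 0 (min 1 ((infdist x P - e/4) * (2/e)))" for x
  have sl: "(2/e)-lipschitz_on UNIV s"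
  proof (rule lipschitz_onI)
    fix x y
    have "dist (s x) (s y) \<le> \<bar>(infdist x P - e/4) * (2/e) - (infdist y P - e/4) * (2/e)\<bar>"
      unfolding s_def dist_real_def by linarith
    also have "\<dots> = \<bar>(2/e) * (infdist x P - infdist y P)\<bar>" by (simp add: algebra_simps)
    also have "\<dots> = (2/e) * \<bar>infdist x P - infdist y P\<bar>"
      using e abs_mult[of "2/e" "infdist x P - infdist y P"] by simp
    also have "\<dots> \<le> (2/e) * dist x y"
      using e infdist_triangle_abs by (intro mult_left_mono) auto
    finally show "dist (s x) (s y) \<le> 2/e * dist x y" .
  qed (use e in simp)
  have s01: "s x \<in> {0..1}" for x by (auto simp: s_def)
  show ?thesis
  proof (intro bexI conjI ballI)
    show "(\<lambda>x. f x + s x *\<^sub>R (g x - f x)) \<in> A" by (rule blend[OF f sl s01])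
    fix p x assume "p \<in> P" "x \<in> ball p (e/4)"
    then have "infdist x P \<le> e/4" by (intro infdist_le2[of p]) (auto simp: dist_commute)
    then have "(infdist x P - e/4) * (2/e) \<le> 0" using e by (intro mult_nonpos_nonneg) auto
    then have "s x = 0" by (simp add: s_def del: times_divide_eq_right)
    then show "f x + s x *\<^sub>R (g x - f x) = f x" by simp
  next
    fix q x assume q: "q \<in> Q" "x \<in> ball q (e/4)"
    have "e \<le> infdist q P"
      unfolding infdist_notempty[OF ne] using q far ne by (intro cINF_greatest) (auto simp: dist_commute)
    then have "infdist x P - e/4 \<ge> e/2"
      using infdist_triangle[of q P x] q by auto
    then have "(infdist x P - e/4) * (2/e) \<ge> (e/2) * (2/e)"
      using e by (intro mult_right_mono) auto
    then have "s x = 1" using e by (simp add: s_def)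
    then show "f x + s x *\<^sub>R (g x - f x) = g x" by simp
  qed
qed

lemma eq_limit:
  assumes "f \<in> A" "g \<in> A" and near: "\<And>d. d > 0 \<Longrightarrow> \<exists>x. dist x p \<le> d \<and> f x = g x"
  shows "f p = g p"
proof -
  have "closed {x. f x = g x}"
    using cont assms(1,2) by (intro closed_Collect_eq) auto
  moreover have "p \<in> closure {x. f x = g x}"
    unfolding closure_approachable
  proof (intro allI impI)
    fix e :: real assume "e > 0"
    then obtain x where "dist x p \<le> e/2" "f x = g x" using near[of "e/2"] by auto
    then show "\<exists>x\<in>{x. f x = g x}. dist x p < e" using \<open>e > 0\<close> by (intro bexI[of _ x]) auto
  qed
  ultimately show ?thesis by auto
qed

end

text \<open>
  Both blending properties reduce to making \<open>\<bar>s x - s z\<bar> * norm (w z)\<close> small for \<open>w = g - f\<close>. For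
  \<open>blend_at\<close> this holds close to \<open>p\<close> because \<open>w\<close> is small there, and away from \<open>p\<close> because \<open>s\<close> is
  Lipschitz there.
\<close>

lemma fun_space_Ustar:
  assumes "\<exists>u::'b::real_normed_vector. u \<noteq> 0"
  shows "fun_space (Ustar :: ('a::metric_space \<Rightarrow> 'b) set)"
proof
  show "\<exists>u::'b. u \<noteq> 0" by fact
  show "(\<lambda>_. 0) \<in> (Ustar :: ('a \<Rightarrow> 'b) set)" by (auto simp: Ustar_def uniformly_continuous_on_const)
  fix f :: "'a \<Rightarrow> 'b" assume f: "f \<in> Ustar"
  show fb: "bounded (range f)" and fu: "uniformly_continuous_on UNIV f"
    using f by (auto simp: Ustar_def)
  { fix s :: "'a \<Rightarrow> real" and L c
    assume s: "L-lipschitz_on UNIV s" "bounded (range s)"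
    show "(\<lambda>x. f x + s x *\<^sub>R c) \<in> Ustar"
    proof -
      have "uniformly_continuous_on UNIV (\<lambda>x. f x + s x *\<^sub>R c)"
        using lipschitz_on_uniformly_continuous[OF s(1)] fu
        by (intro uniformly_continuous_on_add
            bounded_linear.uniformly_continuous_on[OF bounded_linear_scaleR_left])
      moreover have "bounded (range (\<lambda>x. s x *\<^sub>R c))"
        using bounded_linear_image[OF s(2) bounded_linear_scaleR_left[of c]] by (simp add: image_image)
      ultimately show ?thesis using bounded_plus_comp[OF fb] by (auto simp: Ustar_def)
    qed }
  fix g :: "'a \<Rightarrow> 'b" assume g: "g \<in> Ustar"
  define w where "w x = g x - f x" for x
  have wu: "uniformly_continuous_on UNIV w"
    unfolding w_def using f g by (intro uniformly_continuous_on_diff) (auto simp: Ustar_def)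
  obtain M where M: "M > 0" "\<And>x. norm (w x) \<le> M"
    using bounded_minus_comp[of g UNIV f] f g unfolding Ustar_def w_def bounded_pos by auto
  have main: "(\<lambda>x. f x + s x *\<^sub>R (g x - f x)) \<in> Ustar"
    if s: "\<And>x. s x \<in> {0..1}"
      and su: "\<And>e. e > 0 \<Longrightarrow> \<exists>d>0. \<forall>x z. dist x z < d \<longrightarrow> \<bar>s x - s z\<bar> * norm (w z) < e"
    for s :: "'a \<Rightarrow> real"
  proof -
    have s1: "\<bar>s x\<bar> \<le> 1" for x using s[of x] by auto
    have "norm (s x *\<^sub>R w x) \<le> M" for x
      using mult_mono[OF s1[of x] M(2)[of x]] by simp
    then have "bounded (range (\<lambda>x. f x + s x *\<^sub>R w x))"
      by (intro bounded_plus_comp[OF fb]) (auto simp: bounded_iff)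
    moreover have "uniformly_continuous_on UNIV (\<lambda>x. s x *\<^sub>R w x)"
      unfolding uniformly_continuous_on_def
    proof (intro allI impI)
      fix e :: real assume "e > 0"
      then obtain d1 d2 where d: "d1 > 0" "\<And>x z. dist x z < d1 \<Longrightarrow> \<bar>s x - s z\<bar> * norm (w z) < e/2"
        "d2 > 0" "\<And>x z. dist x z < d2 \<Longrightarrow> dist (w x) (w z) < e/2"
        using su[of "e/2"] wu unfolding uniformly_continuous_on_def by (metis UNIV_I half_gt_zero)
      have "dist (s x *\<^sub>R w x) (s z *\<^sub>R w z) < e" if "dist x z < min d1 d2" for x z
        using norm_diff_scaleR_le[OF s1[of x], of "w x" "s z" "w z"] d(2)[of x z] d(4)[of x z] that
        by (auto simp: dist_norm)
      then show "\<exists>d>0. \<forall>x\<in>UNIV. \<forall>x'\<in>UNIV. dist x' x < d \<longrightarrow> dist (s x' *\<^sub>R w x') (s x *\<^sub>R w x) < e"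
        using d(1,3) by (intro exI[of _ "min d1 d2"]) auto
    qed
    then have "uniformly_continuous_on UNIV (\<lambda>x. f x + s x *\<^sub>R w x)"
      using fu by (intro uniformly_continuous_on_add)
    ultimately show ?thesis by (simp add: Ustar_def w_def)
  qed
  { fix s :: "'a \<Rightarrow> real" and L
    assume L: "L-lipschitz_on UNIV s" and s: "\<And>x. s x \<in> {0..1}"
    show "(\<lambda>x. f x + s x *\<^sub>R (g x - f x)) \<in> Ustar"
    proof (rule main[OF s])
      fix e :: real assume "e > 0"
      then obtain d where d: "d > 0" "\<And>x z. dist x z < d \<Longrightarrow> dist (s x) (s z) < e/M"
        using lipschitz_on_uniformly_continuous[OF L] M(1)
        unfolding uniformly_continuous_on_def by (metis UNIV_I divide_pos_pos)
      have "\<bar>s x - s z\<bar> * norm (w z) < e" if "dist x z < d" for x z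
      proof -
        have "\<bar>s x - s z\<bar> * norm (w z) \<le> \<bar>s x - s z\<bar> * M"
          by (intro mult_left_mono M) auto
        also have "\<dots> < e" using d(2)[OF that] M(1) by (simp add: dist_real_def pos_less_divide_eq)
        finally show ?thesis .
      qed
      then show "\<exists>d>0. \<forall>x z. dist x z < d \<longrightarrow> \<bar>s x - s z\<bar> * norm (w z) < e"
        using d(1) by blast
    qed }
  fix s :: "'a \<Rightarrow> real" and C p
  assume eq: "f p = g p" and s: "\<And>x. s x \<in> {0..1}"
    and C: "\<And>x z. dist z p * \<bar>s x - s z\<bar> \<le> C * dist x z"
  show "(\<lambda>x. f x + s x *\<^sub>R (g x - f x)) \<in> Ustar"
  proof (rule main[OF s])
    fix e :: real assume e: "e > 0"
    then obtain d where d: "d > 0" "\<And>x z. dist x z < d \<Longrightarrow> dist (w x) (w z) < e"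
      using wu unfolding uniformly_continuous_on_def by (metis UNIV_I)
    define d' where "d' = e * d / ((\<bar>C\<bar> + 1) * M)"
    have d': "d' > 0" using e d(1) M(1) by (auto simp: d'_def intro!: divide_pos_pos mult_pos_pos)
    have "\<bar>s x - s z\<bar> * norm (w z) < e" if xz: "dist x z < d'" for x z
    proof (cases "dist z p < d")
      case True
      have "\<bar>s x - s z\<bar> \<le> 1" using s[of x] s[of z] by auto
      then have "\<bar>s x - s z\<bar> * norm (w z) \<le> 1 * norm (w z)" by (intro mult_right_mono) auto
      also have "norm (w z) < e" using d(2)[OF True] eq by (simp add: w_def dist_norm)
      finally show ?thesis by simp
    next
      case False
      have "d * (\<bar>s x - s z\<bar> * norm (w z)) \<le> dist z p * (\<bar>s x - s z\<bar> * M)"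
        using False d(1) M by (intro mult_mono) auto
      also have "\<dots> = (dist z p * \<bar>s x - s z\<bar>) * M" by simp
      also have "\<dots> \<le> (C * dist x z) * M" using C[of z x] M(1) by (intro mult_right_mono) auto
      also have "\<dots> \<le> ((\<bar>C\<bar> + 1) * dist x z) * M" using M(1) by (intro mult_right_mono) auto
      also have "\<dots> = ((\<bar>C\<bar> + 1) * M) * dist x z" by simp
      also have "\<dots> < ((\<bar>C\<bar> + 1) * M) * d'"
        using xz M(1) by (intro mult_strict_left_mono) auto
      also have "\<dots> = d * e" using M(1) by (simp add: d'_def)
      finally show ?thesis using d(1) by simp
    qed
    then show "\<exists>d>0. \<forall>x z. dist x z < d \<longrightarrow> \<bar>s x - s z\<bar> * norm (w z) < e"
      using d' by blast
  qed
qed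

lemma Lip_bounded:
  fixes f :: "'a::metric_space \<Rightarrow> 'b::real_normed_vector"
  assumes "bounded (UNIV :: 'a set)" "f \<in> Lip"
  shows "bounded (range f)"
proof -
  obtain L where L: "L-lipschitz_on UNIV f" using assms(2) by (auto simp: Lip_def)
  obtain p M where M: "\<And>x::'a. dist p x \<le> M" using assms(1) by (auto simp: bounded_def)
  have "dist (f p) (f x) \<le> L * M" for x
    using lipschitz_onD[OF L, of p x] mult_left_mono[OF M[of x] lipschitz_on_nonneg[OF L]] by simp
  then show ?thesis by (auto simp: bounded_def)
qed

text \<open>
  Boundedness of the domain makes Lipschitz functions bounded, so that products of Lipschitz
  functions are Lipschitz. For \<open>blend_at\<close> the factor \<open>norm (w z) \<le> W * dist z p\<close> compensates the
  steepness of \<open>s\<close> at \<open>z\<close>.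
\<close>

lemma fun_space_Lip:
  assumes nt: "\<exists>u::'b::real_normed_vector. u \<noteq> 0" and Y: "bounded (UNIV :: 'a::metric_space set)"
  shows "fun_space (Lip :: ('a \<Rightarrow> 'b) set)"
proof
  show "\<exists>u::'b. u \<noteq> 0" by fact
  show "(\<lambda>_. 0) \<in> (Lip :: ('a \<Rightarrow> 'b) set)" by (auto simp: Lip_def lipschitz_on_def)
  fix f :: "'a \<Rightarrow> 'b" assume f: "f \<in> Lip"
  then obtain K where K: "K-lipschitz_on UNIV f" by (auto simp: Lip_def)
  show "bounded (range f)" by (rule Lip_bounded[OF Y f])
  show "uniformly_continuous_on UNIV f" by (rule lipschitz_on_uniformly_continuous[OF K])
  { fix s :: "'a \<Rightarrow> real" and L and c :: 'b
    assume s: "L-lipschitz_on UNIV s"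
    have "(L * norm c)-lipschitz_on UNIV (\<lambda>x. s x *\<^sub>R c)"
    proof (rule lipschitz_onI)
      fix x y
      have "dist (s x *\<^sub>R c) (s y *\<^sub>R c) = dist (s x) (s y) * norm c"
        unfolding dist_norm by (simp flip: scaleR_diff_left)
      then show "dist (s x *\<^sub>R c) (s y *\<^sub>R c) \<le> L * norm c * dist x y"
        using mult_right_mono[OF lipschitz_onD[OF s, of x y], of "norm c"]
        by (simp only: mult_ac norm_ge_zero UNIV_I)
    qed (use lipschitz_on_nonneg[OF s] in simp)
    then show "(\<lambda>x. f x + s x *\<^sub>R c) \<in> Lip"
      using lipschitz_on_add[OF K] unfolding Lip_def by blast }
  fix g :: "'a \<Rightarrow> 'b" assume g: "g \<in> Lip"
  define w where "w x = g x - f x" for x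
  obtain K' where K': "K'-lipschitz_on UNIV g" using g by (auto simp: Lip_def)
  obtain W where W: "W-lipschitz_on UNIV w"
    using lipschitz_on_diff[OF K' K] by (auto simp: w_def)
  obtain M where M: "\<And>x. norm (w x) \<le> M"
    using bounded_minus_comp[of g UNIV f] Lip_bounded[OF Y f] Lip_bounded[OF Y g]
    unfolding w_def bounded_iff by auto
  have main: "(\<lambda>x. f x + s x *\<^sub>R (g x - f x)) \<in> Lip"
    if s: "\<And>x. s x \<in> {0..1}" and D: "\<And>x z. \<bar>s x - s z\<bar> * norm (w z) \<le> D * dist x z"
    for s :: "'a \<Rightarrow> real" and D
  proof -
    have "(W + \<bar>D\<bar>)-lipschitz_on UNIV (\<lambda>x. s x *\<^sub>R w x)"
    proof (rule lipschitz_onI)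
      fix x z
      have "\<bar>s x\<bar> \<le> 1" using s[of x] by auto
      then have "dist (s x *\<^sub>R w x) (s z *\<^sub>R w z) \<le> norm (w x - w z) + \<bar>s x - s z\<bar> * norm (w z)"
        unfolding dist_norm by (rule norm_diff_scaleR_le)
      also have "\<dots> \<le> W * dist x z + D * dist x z"
        using lipschitz_onD[OF W, of x z] D[of x z] by (simp add: dist_norm)
      also have "\<dots> \<le> W * dist x z + \<bar>D\<bar> * dist x z"
        by (intro add_left_mono mult_right_mono) auto
      finally show "dist (s x *\<^sub>R w x) (s z *\<^sub>R w z) \<le> (W + \<bar>D\<bar>) * dist x z"
        by (simp add: algebra_simps)
    qed (use lipschitz_on_nonneg[OF W] in simp)
    from lipschitz_on_add[OF K this] show ?thesis unfolding Lip_def w_def by blast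
  qed
  { fix s :: "'a \<Rightarrow> real" and L
    assume L: "L-lipschitz_on UNIV s" and s: "\<And>x. s x \<in> {0..1}"
    show "(\<lambda>x. f x + s x *\<^sub>R (g x - f x)) \<in> Lip"
    proof (rule main[OF s])
      fix x z
      have "\<bar>s x - s z\<bar> * norm (w z) \<le> (L * dist x z) * M"
        using lipschitz_onD[OF L, of x z] M[of z] lipschitz_on_nonneg[OF L]
        by (intro mult_mono) (auto simp: dist_real_def)
      then show "\<bar>s x - s z\<bar> * norm (w z) \<le> (L * M) * dist x z" by (simp add: mult_ac)
    qed }
  fix s :: "'a \<Rightarrow> real" and C p
  assume eq: "f p = g p" and s: "\<And>x. s x \<in> {0..1}"
    and C: "\<And>x z. dist z p * \<bar>s x - s z\<bar> \<le> C * dist x z"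
  show "(\<lambda>x. f x + s x *\<^sub>R (g x - f x)) \<in> Lip"
  proof (rule main[OF s])
    fix x z
    have "norm (w z) \<le> W * dist z p"
      using lipschitz_onD[OF W, of z p] eq by (simp add: w_def dist_norm)
    then have "\<bar>s x - s z\<bar> * norm (w z) \<le> \<bar>s x - s z\<bar> * (W * dist z p)"
      by (rule mult_left_mono) simp
    also have "\<dots> = W * (dist z p * \<bar>s x - s z\<bar>)" by simp
    also have "\<dots> \<le> W * (C * dist x z)"
      by (rule mult_left_mono[OF C lipschitz_on_nonneg[OF W]])
    finally show "\<bar>s x - s z\<bar> * norm (w z) \<le> (W * C) * dist x z" by simp
  qed
qed

section \<open>Points of the domain tracked by a biseparating map\<close>

lemma perp_pointwise: "perp h f g \<longleftrightarrow> (\<forall>x. f x = h x \<or> g x = h x)"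
  by (auto simp: perp_def carrier_set_def)

locale biseparating_map =
  A: fun_space A + B: fun_space B
  for A :: "('x::complete_space \<Rightarrow> 'e::real_normed_vector) set"
    and B :: "('y::metric_space \<Rightarrow> 'f::real_normed_vector) set" +
  fixes T :: "('x \<Rightarrow> 'e) \<Rightarrow> ('y \<Rightarrow> 'f)"
  assumes bisep: "biseparating A B T"
begin

lemma T_in: "f \<in> A \<Longrightarrow> T f \<in> B"
  and T_surj: "q \<in> B \<Longrightarrow> \<exists>f\<in>A. T f = q"
  and T_inj: "\<lbrakk>f \<in> A; g \<in> A; T f = T g\<rbrakk> \<Longrightarrow> f = g"
  using bisep by (auto simp: biseparating_def bij_betw_def inj_on_def)

lemma T_perp: "\<lbrakk>f \<in> A; g \<in> A; h \<in> A\<rbrakk> \<Longrightarrow>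
    (\<forall>x. f x = h x \<or> g x = h x) \<longleftrightarrow> (\<forall>y. T f y = T h y \<or> T g y = T h y)"
  using bisep by (simp add: biseparating_def perp_pointwise)

text \<open>
  A point \<open>x\<close> is near \<open>y\<close> at scale \<open>d\<close> when the germ of \<open>h\<close> at \<open>x\<close> determines the value of
  \<open>T h\<close> at some point within \<open>d\<close> of \<open>y\<close>. It is defined relative to \<open>h\<close> because $T$ is not
  additive; that the choice of \<open>h\<close> is immaterial in the limit is the content of \<open>near_close\<close> below.
\<close>

definition near :: "('x \<Rightarrow> 'e) \<Rightarrow> real \<Rightarrow> 'x \<Rightarrow> 'y \<Rightarrow> bool" where
  "near h d x y \<longleftrightarrow> (\<forall>f\<in>A. (\<exists>r>0. \<forall>z\<in>ball x r. f z = h z) \<longrightarrow>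
    (\<exists>y'. dist y' y \<le> d \<and> T f y' = T h y'))"

lemma near_mono: "near h d x y \<Longrightarrow> d \<le> d' \<Longrightarrow> near h d' x y"
  unfolding near_def by (meson order_trans)

text \<open>
  \<open>U\<close> is the carrier, relative to \<open>h\<close>, of the preimage \<open>g\<close> of \<open>T h\<close> plus a bump on the ball of radius
  \<open>d\<close> around \<open>y\<close>. If \<open>f = h\<close> near \<open>x \<in> U\<close>, choose \<open>g' \<noteq> h\<close> whose carrier lies in \<open>U\<close> and in the region where
  \<open>f = h\<close>. Then \<open>f\<close> and \<open>g'\<close> are disjoint relative to \<open>h\<close>, so \<open>T f = T h\<close> wherever \<open>T g' \<noteq> T h\<close>. Such points
  lie within \<open>d\<close> of \<open>y\<close>: if one were farther away, the preimage \<open>k\<close> of \<open>T h\<close> plus a bump around it would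
  be disjoint from \<open>g\<close> relative to \<open>h\<close>, hence from \<open>g'\<close>, although \<open>T k\<close> and \<open>T g'\<close> both differ from \<open>T h\<close> there.
\<close>

lemma near_open:
  assumes h: "h \<in> A" and d: "d > 0"
  shows "\<exists>U. open U \<and> U \<noteq> {} \<and> (\<forall>x\<in>U. near h d x y)"
proof -
  obtain u :: 'f where u: "u \<noteq> 0" using B.nontrivial by blast
  obtain v :: 'e where v: "v \<noteq> 0" using A.nontrivial by blast
  obtain g where g: "g \<in> A" "T g = (\<lambda>z. T h z + max 0 (d - dist z y) *\<^sub>R u)"
    using T_surj[OF B.bump[OF T_in[OF h], of d y u]] by blast
  define U where "U = {x. g x \<noteq> h x}"
  have "open U"
    unfolding U_def using A.cont g(1) h by (intro open_Collect_neq) auto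
  moreover have "U \<noteq> {}"
  proof
    assume "U = {}"
    then have "g = h" by (auto simp: U_def)
    then have "T h y = T h y + max 0 (d - dist y y) *\<^sub>R u" using g(2) by metis
    then show False using u d by simp
  qed
  moreover have "near h d x y" if x: "x \<in> U" for x
    unfolding near_def
  proof (intro ballI impI)
    fix f assume f: "f \<in> A" "\<exists>r>0. \<forall>z\<in>ball x r. f z = h z"
    then obtain r where r: "r > 0" "\<And>z. z \<in> ball x r \<Longrightarrow> f z = h z" by blast
    obtain r' where r': "r' > 0" "ball x r' \<subseteq> U" using \<open>open U\<close> x open_contains_ball by metis
    define g' where "g' z = h z + max 0 (min r r' - dist z x) *\<^sub>R v" for z
    have g': "g' \<in> A" unfolding g'_def by (rule A.bump[OF h])
    have out: "g' z = h z" if "z \<notin> ball x (min r r')" for z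
      using that by (auto simp: g'_def dist_commute max_def)
    have "g' x \<noteq> h x" using r(1) r'(1) v by (simp add: g'_def)
    then have "T g' \<noteq> T h" using T_inj[OF g' h] by auto
    then obtain y1 where y1: "T g' y1 \<noteq> T h y1" by blast
    have "\<forall>z. f z = h z \<or> g' z = h z" using out r(2) by auto
    then have "T f y1 = T h y1" using T_perp[OF f(1) g' h] y1 by blast
    moreover have "dist y1 y \<le> d"
    proof (rule ccontr)
      assume far: "\<not> dist y1 y \<le> d"
      obtain k where k: "k \<in> A" "T k = (\<lambda>z. T h z + max 0 ((dist y1 y - d) - dist z y1) *\<^sub>R u)"
        using T_surj[OF B.bump[OF T_in[OF h], of "dist y1 y - d" y1 u]] by blast
      have "max 0 ((dist y1 y - d) - dist z y1) = 0 \<or> max 0 (d - dist z y) = 0" for z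
        using dist_triangle[of y1 y z] by (auto simp: dist_commute max_def)
      then have "\<forall>z. T k z = T h z \<or> T g z = T h z" unfolding k(2) g(2) by (metis add_0_right scaleR_zero_left)
      then have "\<forall>z. k z = h z \<or> g z = h z" using T_perp[OF k(1) g(1) h] by blast
      moreover have "g' z = h z" if "g z = h z" for z
      proof -
        have "z \<notin> U" using that by (simp add: U_def)
        then have "z \<notin> ball x (min r r')" using r'(2) by auto
        then show ?thesis by (rule out)
      qed
      ultimately have "\<forall>z. k z = h z \<or> g' z = h z" by blast
      then have "T k y1 = T h y1" using T_perp[OF k(1) g' h] y1 by blast
      then show False using far u by (simp add: k(2))
    qed
    ultimately show "\<exists>y'. dist y' y \<le> d \<and> T f y' = T h y'" by blast
  qed
  ultimately show ?thesis by blast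
qed

lemma near_ex: "h \<in> A \<Longrightarrow> d > 0 \<Longrightarrow> \<exists>x. near h d x y"
  using near_open by fast

text \<open>
  Otherwise \<open>h\<close> and \<open>h'\<close> could be glued, after passing to a subsequence, along points \<open>x n\<close> and \<open>x' n\<close>
  that are near almost equal points of the codomain. The glued function has an image that takes
  almost equal values at almost equal points, whereas \<open>T h\<close> and \<open>T h'\<close> differ by at least \<open>c\<close>.
\<close>

lemma near_close_apart:
  assumes h: "h \<in> A" "h' \<in> A" and c: "c > 0" "\<And>y. c \<le> norm (T h y - T h' y)" and e: "e > 0"
  shows "\<exists>d>0. \<forall>x x' y y'. near h d x y \<and> near h' d x' y' \<and> dist y y' < d \<longrightarrow> dist x x' < e"
proof (rule ccontr)
  assume "\<not> ?thesis"
  then have "\<exists>x x' y y'. near h d x y \<and> near h' d x' y' \<and> dist y y' < d \<and> e \<le> dist x x'" if "d > 0" for d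
    using that by (meson not_less)
  then have "\<forall>n. \<exists>x x' y y'. near h (inverse (real (Suc n))) x y \<and> near h' (inverse (real (Suc n))) x' y' \<and>
      dist y y' < inverse (real (Suc n)) \<and> e \<le> dist x x'"
    by (simp del: of_nat_Suc)
  then obtain x x' y y' where
    near: "\<And>n. near h (inverse (real (Suc n))) (x n) (y n)" "\<And>n. near h' (inverse (real (Suc n))) (x' n) (y' n)"
    and yy: "\<And>n. dist (y n) (y' n) < inverse (real (Suc n))" and far: "\<And>n. e \<le> dist (x n) (x' n)"
    by metis
  obtain N where N: "infinite N" "\<And>m n. m \<in> N \<Longrightarrow> n \<in> N \<Longrightarrow> e/4 \<le> dist (x m) (x' n)"
    using efremovich[of e x x'] e far by blast
  have "N \<noteq> {}" using N(1) by auto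
  then obtain f where f: "f \<in> A" "\<And>n z. n \<in> N \<Longrightarrow> z \<in> ball (x n) (e/16) \<Longrightarrow> f z = h z"
    "\<And>n z. n \<in> N \<Longrightarrow> z \<in> ball (x' n) (e/16) \<Longrightarrow> f z = h' z"
  proof -
    have "\<exists>k\<in>A. (\<forall>p\<in>x ` N. \<forall>z\<in>ball p (e/4/4). k z = h z) \<and> (\<forall>q\<in>x' ` N. \<forall>z\<in>ball q (e/4/4). k z = h' z)"
      using N(2) e \<open>N \<noteq> {}\<close> by (intro A.glue[OF h]) auto
    then show ?thesis using that by auto
  qed
  have ev: "\<exists>d>0. \<forall>y z. dist y z < d \<longrightarrow> dist (T k y) (T k z) < c/3" if "k \<in> A" for k
    using B.ucont[OF T_in[OF that]] c(1) unfolding uniformly_continuous_on_def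
    by (metis UNIV_I divide_pos_pos zero_less_numeral)
  obtain d1 d2 d3 where
    d1: "d1 > 0" "\<And>y z. dist y z < d1 \<Longrightarrow> dist (T h y) (T h z) < c/3" and
    d2: "d2 > 0" "\<And>y z. dist y z < d2 \<Longrightarrow> dist (T h' y) (T h' z) < c/3" and
    d3: "d3 > 0" "\<And>y z. dist y z < d3 \<Longrightarrow> dist (T f y) (T f z) < c/3"
    using ev[OF h(1)] ev[OF h(2)] ev[OF f(1)] by metis
  define d where "d = min d1 (min d2 d3)"
  have "d > 0" using d1(1) d2(1) d3(1) by (simp add: d_def)
  then obtain n0 where n0: "inverse (real (Suc n0)) < d/3" using reals_Archimedean[of "d/3"] by auto
  obtain n where n: "n \<in> N" "n0 < n" using N(1) by (meson infinite_nat_iff_unbounded)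
  have inv: "inverse (real (Suc n)) < d/3"
    using n0 n(2) by (smt (verit) inverse_less_iff_less of_nat_0_less_iff of_nat_less_iff zero_less_Suc Suc_less_eq)
  obtain z where z: "dist z (y n) < d/3" "T f z = T h z"
    using near(1)[of n] f(1,2) n(1) e inv unfolding near_def by (metis divide_pos_pos le_less_trans zero_less_numeral)
  obtain z' where z': "dist z' (y' n) < d/3" "T f z' = T h' z'"
    using near(2)[of n] f(1,3) n(1) e inv unfolding near_def by (metis divide_pos_pos le_less_trans zero_less_numeral)
  have "dist (y n) z' < d" "dist z z' < d"
    using dist_triangle[of "y n" z' "y' n"] dist_triangle[of z z' "y n"] z(1) z'(1) yy[of n] inv \<open>d > 0\<close>
    by (auto simp: dist_commute)
  then have "dist (T h z) (T h (y n)) < c/3" "dist (T f z) (T f z') < c/3" "dist (T h' z') (T h' (y n)) < c/3"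
    using d1(2)[of z "y n"] d2(2)[of z' "y n"] d3(2)[of z z'] z(1) \<open>d > 0\<close> by (auto simp: d_def dist_commute)
  then have "dist (T h (y n)) (T h' (y n)) < c"
    using dist_triangle[of "T h (y n)" "T h' (y n)" "T h z"] dist_triangle[of "T h z" "T h' (y n)" "T h' z'"]
      z(2) z'(2) by (auto simp: dist_commute)
  then show False using c(2)[of "y n"] by (simp add: dist_norm)
qed

text \<open>
  Compare \<open>h\<close> and \<open>h'\<close> with a third function whose image is a large translate of \<open>T h\<close>, which is
  uniformly away from both \<open>T h\<close> and \<open>T h'\<close> because these are bounded.
\<close>

lemma near_close:
  assumes h: "h \<in> A" "h' \<in> A" and e: "e > 0"
  shows "\<exists>d>0. \<forall>x x' y y'. near h d x y \<and> near h' d x' y' \<and> dist y y' < d \<longrightarrow> dist x x' < e"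
proof -
  obtain u :: 'f where u: "norm u = 1"
    using B.nontrivial by (metis norm_sgn)
  obtain M where M: "M > 0" "\<And>y. norm (T h y - T h' y) \<le> M"
    using bounded_minus_comp[OF B.bdd B.bdd, OF T_in T_in, OF h] by (auto simp: bounded_pos)
  obtain k where k: "k \<in> A" "T k = (\<lambda>y. T h y + (M + 1) *\<^sub>R u)"
    using T_surj[OF B.translate[OF T_in[OF h(1)]]] by blast
  have uM: "norm ((M + 1) *\<^sub>R u) = M + 1" using u M(1) by simp
  have 1: "1 \<le> norm (T h y - T k y)" for y
    using uM M(1) by (simp add: k(2))
  have 2: "1 \<le> norm (T k y - T h' y)" for y
  proof -
    have "T k y - T h' y = (M + 1) *\<^sub>R u + (T h y - T h' y)" by (simp add: k(2))
    then have "norm (T k y - T h' y) = norm ((M + 1) *\<^sub>R u + (T h y - T h' y))" by (rule arg_cong)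
    then show ?thesis
      using norm_diff_ineq[of "(M + 1) *\<^sub>R u" "T h y - T h' y"] M(2)[of y] unfolding uM by linarith
  qed
  obtain d1 where d1: "d1 > 0"
    "\<And>x x' y y'. near h d1 x y \<Longrightarrow> near k d1 x' y' \<Longrightarrow> dist y y' < d1 \<Longrightarrow> dist x x' < e/2"
    using near_close_apart[OF h(1) k(1) zero_less_one 1 half_gt_zero[OF e]] by metis
  obtain d2 where d2: "d2 > 0"
    "\<And>x x' y y'. near k d2 x y \<Longrightarrow> near h' d2 x' y' \<Longrightarrow> dist y y' < d2 \<Longrightarrow> dist x x' < e/2"
    using near_close_apart[OF k(1) h(2) zero_less_one 2 half_gt_zero[OF e]] by metis
  have "dist x x' < e" if n: "near h (min d1 d2) x y" "near h' (min d1 d2) x' y'" "dist y y' < min d1 d2"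
    for x x' y y'
  proof -
    obtain x0 where x0: "near k (min d1 d2) x0 y" using near_ex[OF k(1)] d1(1) d2(1) by fastforce
    have "dist x x0 < e/2" using n(1) x0 d1 by (intro d1(2)[of x y x0 y]) (auto elim: near_mono)
    moreover have "dist x0 x' < e/2" using n(2,3) x0 by (intro d2(2)[of x0 y x' y']) (auto elim: near_mono)
    ultimately show ?thesis using dist_triangle[of x x' x0] by simp
  qed
  then show ?thesis using d1(1) d2(1) by (intro exI[of _ "min d1 d2"]) auto
qed

text \<open>
  By \<open>near_close\<close>, points that are near \<open>y\<close> at smaller and smaller scales form a Cauchy sequence, with
  a modulus that does not depend on \<open>y\<close>.
\<close>

lemma tracking:
  "\<exists>\<psi>. uniformly_continuous_on UNIV \<psi> \<and>
    (\<forall>h\<in>A. \<forall>e>0. \<exists>d>0. \<forall>x y. near h d x y \<longrightarrow> dist x (\<psi> y) < e)"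
proof -
  let ?h = "\<lambda>_. 0 :: 'e"
  have "\<exists>x. near ?h (inverse (real (Suc n))) x y" for n y
    using near_ex[OF A.zero] by simp
  then obtain X where X: "\<And>n y. near ?h (inverse (real (Suc n))) (X n y) y" by metis
  have X_near: "\<exists>N. \<forall>n\<ge>N. \<forall>y. near ?h d (X n y) y" if d: "d > 0" for d
  proof -
    obtain N where N: "inverse (real (Suc N)) < d" using reals_Archimedean[OF d] by blast
    have "inverse (real (Suc n)) \<le> d" if "n \<ge> N" for n
    proof -
      have "inverse (real (Suc n)) \<le> inverse (real (Suc N))" using that by (intro le_imp_inverse_le) auto
      then show ?thesis using N by linarith
    qed
    then show ?thesis using X near_mono by blast
  qed
  have "Cauchy (\<lambda>n. X n y)" for y
  proof (rule metric_CauchyI)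
    fix e :: real assume "e > 0"
    then obtain d where d: "d > 0" "\<And>x x' y y'. near ?h d x y \<Longrightarrow> near ?h d x' y' \<Longrightarrow> dist y y' < d \<Longrightarrow> dist x x' < e"
      using near_close[OF A.zero A.zero] by metis
    then show "\<exists>M. \<forall>m\<ge>M. \<forall>n\<ge>M. dist (X m y) (X n y) < e"
      using X_near[OF d(1)] by (metis dist_self)
  qed
  then obtain \<psi> where \<psi>: "\<And>y. (\<lambda>n. X n y) \<longlonglongrightarrow> \<psi> y"
    unfolding Cauchy_convergent_iff convergent_def by metis
  have track: "\<exists>d>0. \<forall>x y y'. near h d x y \<and> dist y y' < d \<longrightarrow> dist x (\<psi> y') < e" if h: "h \<in> A" and e: "e > 0" for h e
  proof -
    obtain d where d: "d > 0"
      "\<And>x x' y y'. near h d x y \<Longrightarrow> near ?h d x' y' \<Longrightarrow> dist y y' < d \<Longrightarrow> dist x x' < e/2"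
      using near_close[OF h A.zero half_gt_zero[OF e]] by metis
    have "dist x (\<psi> y') < e" if n: "near h d x y" "dist y y' < d" for x y y'
    proof -
      have "(\<lambda>n. dist x (X n y')) \<longlonglongrightarrow> dist x (\<psi> y')" by (intro tendsto_intros \<psi>)
      moreover have "\<exists>N. \<forall>n\<ge>N. dist x (X n y') \<le> e/2"
        using X_near[OF d(1)] d(2)[OF n(1) _ n(2)] less_imp_le by blast
      ultimately have "dist x (\<psi> y') \<le> e/2" by (rule LIMSEQ_le_const2)
      then show ?thesis using \<open>e > 0\<close> by simp
    qed
    then show ?thesis using d(1) by blast
  qed
  have "uniformly_continuous_on UNIV \<psi>"
    unfolding uniformly_continuous_on_def
  proof (intro allI impI)
    fix e :: real assume "e > 0"
    then obtain d where d: "d > 0" "\<And>x y y'. near ?h d x y \<Longrightarrow> dist y y' < d \<Longrightarrow> dist x (\<psi> y') < e/2"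
      using track[OF A.zero half_gt_zero] by metis
    have "dist (\<psi> y') (\<psi> y) < e" if "dist y' y < d" for y y'
    proof -
      obtain x where x: "near ?h d x y" using near_ex[OF A.zero d(1)] by blast
      then show ?thesis
        using d(2)[OF x, of y] d(2)[OF x, of y'] d(1) that dist_triangle[of "\<psi> y'" "\<psi> y" x]
        by (auto simp: dist_commute)
    qed
    then show "\<exists>d>0. \<forall>x\<in>UNIV. \<forall>x'\<in>UNIV. dist x' x < d \<longrightarrow> dist (\<psi> x') (\<psi> x) < e" using d(1) by blast
  qed
  moreover have "\<exists>d>0. \<forall>x y. near h d x y \<longrightarrow> dist x (\<psi> y) < e" if he: "h \<in> A" "e > 0" for h e
    using track[OF he] by (metis dist_self)
  ultimately show ?thesis by blast
qed

text \<open>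
  At an isolated point \<open>\<psi> y\<close>, the functions \<open>f\<close> and \<open>g\<close> agree on a neighbourhood of every point that
  is near enough to \<open>y\<close>. Otherwise choose points \<open>w n \<noteq> \<psi> y\<close> near \<open>y\<close> that converge quickly to \<open>\<psi> y\<close>,
  near with respect to \<open>f\<close> for even \<open>n\<close> and with respect to \<open>g\<close> for odd \<open>n\<close>. A function \<open>k\<close> that
  equals \<open>f\<close> around the former and \<open>g\<close> around the latter has \<open>T k y = T f y\<close> and \<open>T k y = T g y\<close>.
\<close>

theorem pointwise_dependence:
  "\<exists>\<psi>. uniformly_continuous_on UNIV \<psi> \<and>
    (\<forall>f\<in>A. \<forall>g\<in>A. \<forall>y. f (\<psi> y) = g (\<psi> y) \<longrightarrow> T f y = T g y)"
proof -
  obtain \<psi> where uc: "uniformly_continuous_on UNIV \<psi>"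
    and track: "\<And>h e. h \<in> A \<Longrightarrow> e > 0 \<Longrightarrow> \<exists>d>0. \<forall>x y. near h d x y \<longrightarrow> dist x (\<psi> y) < e"
    using tracking by blast
  have "T f y = T g y" if f: "f \<in> A" and g: "g \<in> A" and eq: "f (\<psi> y) = g (\<psi> y)" for f g y
  proof -
    let ?p = "\<psi> y"
    have U: "\<exists>U. open U \<and> U \<noteq> {} \<and> (\<forall>z\<in>U. near h d z y \<and> dist z ?p < e)"
      if h: "h \<in> A" and e: "e > 0" and d: "d > 0" for h e d
    proof -
      obtain d' where d': "d' > 0" "\<And>x. near h d' x y \<Longrightarrow> dist x ?p < e" using track[OF h e] by blast
      obtain U where "open U" "U \<noteq> {}" "\<And>z. z \<in> U \<Longrightarrow> near h (min d d') z y"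
        using near_open[OF h, of "min d d'" y] d'(1) d by force
      moreover have "near h d z y \<and> dist z ?p < e" if "z \<in> U" for z
        using d'(2)[of z] near_mono[OF \<open>\<And>z. z \<in> U \<Longrightarrow> near h (min d d') z y\<close>[OF that]] by simp
      ultimately show ?thesis by blast
    qed
    show ?thesis
    proof (cases "\<forall>e>0. \<exists>z. z \<noteq> ?p \<and> dist z ?p < e")
      case False
      then obtain r where r: "r > 0" "\<And>z. dist z ?p < r \<Longrightarrow> z = ?p" by blast
      show ?thesis
      proof (rule B.eq_limit[OF T_in T_in, OF f g])
        fix d :: real assume "d > 0"
        then obtain z where z: "near g d z y" "dist z ?p < r" using U[OF g r(1)] by fast
        then have "z = ?p" using r(2) by blast
        moreover have "f x = g x" if "x \<in> ball ?p r" for x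
          using r(2)[of x] that eq by (simp add: dist_commute)
        ultimately have "\<forall>x\<in>ball z r. f x = g x" by blast
        then show "\<exists>y'. dist y' y \<le> d \<and> T f y' = T g y'" using z(1) f r(1) unfolding near_def by blast
      qed
    next
      case True
      define Q where "Q n z \<longleftrightarrow> near (if even n then f else g) ((1/2)^n) z y" for n :: nat and z
      have "\<exists>z. Q n z \<and> z \<noteq> ?p \<and> dist z ?p < e" if e: "e > 0" for n e
      proof -
        let ?h = "if even n then f else g"
        have h: "?h \<in> A" using f g by simp
        have pow: "(1/2::real)^n > 0" by simp
        obtain V where V: "open V" "V \<noteq> {}"
          "\<And>z. z \<in> V \<Longrightarrow> near ?h ((1/2)^n) z y \<and> dist z ?p < e"
          using U[OF h e pow] by blast
        then obtain z0 where z0: "z0 \<in> V" by blast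
        have "\<exists>z\<in>V. z \<noteq> ?p"
        proof (cases "z0 = ?p")
          case center: True
          obtain r where r: "r > 0" "ball z0 r \<subseteq> V" using V(1) z0 open_contains_ball by metis
          then obtain z where z: "z \<noteq> ?p" "dist z ?p < r" using True by blast
          then have "z \<in> ball z0 r" by (simp add: center dist_commute)
          then show ?thesis using r(2) z(1) by blast
        qed (use z0 in blast)
        then show ?thesis using V(3) unfolding Q_def by blast
      qed
      then obtain w where w: "\<And>n. Q n (w n)" "\<And>n. w n \<noteq> ?p" "\<And>n. dist (w n) ?p < (1/2)^n"
        and half: "\<And>m n. m < n \<Longrightarrow> dist (w n) ?p \<le> dist (w m) ?p / 2"
        using fast_sequence[of Q ?p] by blast
      obtain s :: "'x \<Rightarrow> real" where s: "\<And>z. s z \<in> {0..1}" "\<And>x z. dist z ?p * \<bar>s x - s z\<bar> \<le> 8 * dist x z"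
        and s_w: "\<And>n. \<exists>r>0. \<forall>z\<in>ball (w n) r. s z = (if even n then 0 else 1)"
        using oscillating_cutoff[OF w(2,3) half] by blast
      define k where "k z = f z + s z *\<^sub>R (g z - f z)" for z
      have k: "k \<in> A" unfolding k_def by (rule A.blend_at[OF f g eq s])
      have small: "\<exists>y'. dist y' y \<le> (1/2)^n \<and> T k y' = T (if even n then f else g) y'" for n
      proof -
        obtain r where "r > 0" "\<And>z. z \<in> ball (w n) r \<Longrightarrow> s z = (if even n then 0 else 1)" using s_w by blast
        then have "\<exists>r>0. \<forall>z\<in>ball (w n) r. k z = (if even n then f else g) z"
          by (intro exI[of _ r]) (simp add: k_def)
        then show ?thesis using w(1)[of n] k unfolding Q_def near_def by blast
      qed
      have pow: "\<exists>n. (1/2)^(2*n) \<le> d \<and> (1/2)^(Suc (2*n)) \<le> d" if d: "d > 0" for d :: real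
      proof -
        obtain n where n: "(1/2::real)^n < d" using real_arch_pow_inv[OF d, of "1/2"] by auto
        have "(1/2::real)^(2*n) \<le> (1/2)^n" "(1/2::real)^(Suc (2*n)) \<le> (1/2)^n"
          by (rule power_decreasing; simp)+
        then show ?thesis using n by (intro exI[of _ n]) linarith
      qed
      have "T k y = T f y"
      proof (rule B.eq_limit[OF T_in T_in, OF k f])
        fix d :: real assume "d > 0"
        then obtain n where "(1/2)^(2*n) \<le> d" using pow by blast
        moreover obtain y' where "dist y' y \<le> (1/2)^(2*n)" "T k y' = T f y'"
          using small[of "2*n"] by auto
        ultimately show "\<exists>y'. dist y' y \<le> d \<and> T k y' = T f y'"
          by (intro exI[of _ y'] conjI) linarith+
      qed
      moreover have "T k y = T g y"
      proof (rule B.eq_limit[OF T_in T_in, OF k g])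
        fix d :: real assume "d > 0"
        then obtain n where "(1/2)^(Suc (2*n)) \<le> d" using pow by blast
        moreover obtain y' where "dist y' y \<le> (1/2)^(Suc (2*n))" "T k y' = T g y'"
          using small[of "Suc (2*n)"] by auto
        ultimately show "\<exists>y'. dist y' y \<le> d \<and> T k y' = T g y'"
          by (intro exI[of _ y'] conjI) linarith+
      qed
      ultimately show ?thesis by simp
    qed
  qed
  then show ?thesis using uc by blast
qed

end

section \<open>The uniform homeomorphism\<close>

lemma uniformly_continuous_dist:
  assumes "uniformly_continuous_on UNIV f" "e > 0"
  obtains d where "d > 0" "\<And>x y. dist x y < d \<Longrightarrow> dist (f x) (f y) < e"
  using assms unfolding uniformly_continuous_on_def by (metis UNIV_I)

lemma biseparating_inv_into:
  assumes "biseparating A B T"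
  shows "biseparating B A (inv_into A T)"
proof -
  have bij: "bij_betw T A B" using assms by (simp add: biseparating_def)
  have "inv_into A T f \<in> A" "T (inv_into A T f) = f" if "f \<in> B" for f
    using that bij by (auto simp: bij_betw_def inv_into_into f_inv_into_f)
  then show ?thesis
    using assms bij_betw_inv_into[OF bij] unfolding biseparating_def by metis
qed

text \<open>
  The maps \<open>\<psi>\<close> and \<open>\<phi>\<close> tracked by \<open>T\<close> and by its inverse are inverse to each other: the value of \<open>f\<close> at
  \<open>\<psi> (\<phi> x)\<close> determines that of \<open>T f\<close> at \<open>\<phi> x\<close>, hence that of \<open>f\<close> at \<open>x\<close>, and the functions separate
  points.
\<close>

theorem biseparating_homeomorphism:
  fixes A :: "('x::complete_space \<Rightarrow> 'e::real_normed_vector) set"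
    and B :: "('y::complete_space \<Rightarrow> 'f::real_normed_vector) set"
  assumes A: "fun_space A" and B: "fun_space B" and T: "biseparating A B T"
  shows "\<exists>\<psi> \<phi>. uniformly_continuous_on UNIV \<psi> \<and> uniformly_continuous_on UNIV \<phi> \<and>
    (\<forall>x. \<psi> (\<phi> x) = x) \<and> (\<forall>y. \<phi> (\<psi> y) = y) \<and>
    (\<forall>f\<in>A. \<forall>g\<in>A. \<forall>y. T f y = T g y \<longleftrightarrow> f (\<psi> y) = g (\<psi> y))"
proof -
  interpret A: fun_space A by fact
  interpret B: fun_space B by fact
  interpret T: biseparating_map A B T by unfold_locales fact
  interpret S: biseparating_map B A "inv_into A T"
    by unfold_locales (rule biseparating_inv_into[OF T])
  have ST: "inv_into A T (T f) = f" if "f \<in> A" for f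
    using that T by (auto simp: biseparating_def intro: bij_betw_inv_into_left)
  obtain \<psi> where \<psi>: "uniformly_continuous_on UNIV \<psi>"
    "\<And>f g y. f \<in> A \<Longrightarrow> g \<in> A \<Longrightarrow> f (\<psi> y) = g (\<psi> y) \<Longrightarrow> T f y = T g y"
    using T.pointwise_dependence by metis
  obtain \<phi> where \<phi>: "uniformly_continuous_on UNIV \<phi>"
    "\<And>f g x. f \<in> B \<Longrightarrow> g \<in> B \<Longrightarrow> f (\<phi> x) = g (\<phi> x) \<Longrightarrow> inv_into A T f x = inv_into A T g x"
    using S.pointwise_dependence by metis
  have \<phi>': "f x = g x" if "f \<in> A" "g \<in> A" "T f (\<phi> x) = T g (\<phi> x)" for f g x
    using \<phi>(2)[OF T.T_in T.T_in, OF that] ST that by simp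
  have 1: "\<psi> (\<phi> x) = x" for x
  proof (rule ccontr)
    assume "\<psi> (\<phi> x) \<noteq> x"
    then obtain f where f: "f \<in> A" "f x \<noteq> 0" "f (\<psi> (\<phi> x)) = 0" using A.separates by metis
    then have "T f (\<phi> x) = T (\<lambda>_. 0) (\<phi> x)" using \<psi>(2)[OF f(1) A.zero] by simp
    then show False using \<phi>'[OF f(1) A.zero] f(2) by simp
  qed
  have 2: "\<phi> (\<psi> y) = y" for y
  proof (rule ccontr)
    assume "\<phi> (\<psi> y) \<noteq> y"
    then obtain q where q: "q \<in> B" "q y \<noteq> 0" "q (\<phi> (\<psi> y)) = 0" using B.separates by metis
    obtain f g where fg: "f \<in> A" "T f = q" "g \<in> A" "T g = (\<lambda>_. 0)"
      using T.T_surj[OF q(1)] T.T_surj[OF B.zero] by blast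
    have "f (\<psi> y) = g (\<psi> y)" using q(3) fg by (intro \<phi>'[OF fg(1,3)]) simp
    then have "T f y = T g y" by (rule \<psi>(2)[OF fg(1,3)])
    then show False using fg q(2) by simp
  qed
  have 3: "T f y = T g y \<longleftrightarrow> f (\<psi> y) = g (\<psi> y)" if "f \<in> A" "g \<in> A" for f g y
    using \<psi>(2)[OF that, of y] \<phi>'[OF that, of "\<psi> y"] 2 by auto
  show ?thesis using \<psi>(1) \<phi>(1) 1 2 3 by blast
qed

section \<open>Separatedness\<close>

lemma uniformly_continuous_uniform_limit:
  fixes f :: "nat \<Rightarrow> 'a::metric_space \<Rightarrow> 'b::metric_space"
  assumes lim: "uniform_limit UNIV f g sequentially" and f: "\<And>n. uniformly_continuous_on UNIV (f n)"
  shows "uniformly_continuous_on UNIV g"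
  unfolding uniformly_continuous_on_def
proof (intro allI impI)
  fix e :: real assume e: "e > 0"
  then obtain n where n: "\<And>x. dist (f n x) (g x) < e/3"
    using uniform_limitD[OF lim, of "e/3"] by (auto simp: eventually_sequentially)
  obtain d where d: "d > 0" "\<And>x y. dist y x < d \<Longrightarrow> dist (f n y) (f n x) < e/3"
    using f[of n] e unfolding uniformly_continuous_on_def by (metis UNIV_I divide_pos_pos zero_less_numeral)
  have "dist (g y) (g x) < e" if "dist y x < d" for x y
    using dist_triangle[of "g y" "g x" "f n y"] dist_triangle[of "f n y" "g x" "f n x"]
      n[of x] n[of y] d(2)[OF that] by (simp add: dist_commute)
  then show "\<exists>d>0. \<forall>x\<in>UNIV. \<forall>x'\<in>UNIV. dist x' x < d \<longrightarrow> dist (g x') (g x) < e"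
    using d(1) by blast
qed

text \<open>
  The values must tend to 0 since the radii \<open>r n\<close> may do so. With geometric decay the sum of the scaled
  bumps converges uniformly, so overlapping supports do no harm; a bump only has to vanish at the other
  prescribed points.
\<close>

lemma Ustar_interpolation:
  fixes x :: "nat \<Rightarrow> 'x::metric_space" and e :: "nat \<Rightarrow> 'e::banach"
  assumes nt: "\<exists>u::'e. u \<noteq> 0"
    and r: "\<And>n. r n > 0" and apart: "\<And>m n. m \<noteq> n \<Longrightarrow> r n \<le> dist (x n) (x m)"
    and apart_S: "\<And>n z. z \<in> S \<Longrightarrow> r n \<le> dist (x n) z"
    and e: "\<And>n. norm (e n) \<le> (1/2)^n"
  shows "\<exists>f\<in>Ustar. (\<forall>n. f (x n) = e n) \<and> (\<forall>z\<in>S. f z = 0)"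
proof -
  interpret fun_space "Ustar :: ('x \<Rightarrow> 'e) set" by (rule fun_space_Ustar[OF nt])
  define F where "F n z = max 0 (r n - dist z (x n)) *\<^sub>R ((1 / r n) *\<^sub>R e n)" for n z
  have F_le: "norm (F n z) \<le> (1/2)^n" for n z
  proof -
    have "norm (F n z) = (max 0 (r n - dist z (x n)) / r n) * norm (e n)"
      using r[of n] by (simp add: F_def)
    also have "\<dots> \<le> 1 * norm (e n)"
      using r[of n] by (intro mult_right_mono) (auto simp: max_def)
    finally show ?thesis using e[of n] by simp
  qed
  define f where "f z = (\<Sum>n. F n z)" for z
  have partial: "(\<lambda>z. \<Sum>i<n. F i z) \<in> Ustar" for n
  proof (induction n)
    case (Suc n)
    then show ?case using bump[OF Suc, of "r n" "x n" "(1 / r n) *\<^sub>R e n"] by (simp add: F_def)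
  qed (simp add: zero)
  have "uniform_limit UNIV (\<lambda>n z. \<Sum>i<n. F i z) f sequentially"
    unfolding f_def by (rule Weierstrass_m_test[OF F_le]) simp
  then have "uniformly_continuous_on UNIV f"
    by (rule uniformly_continuous_uniform_limit) (use partial in \<open>simp add: Ustar_def\<close>)
  moreover have "norm (f z) \<le> (\<Sum>n. (1/2)^n)" for z
    unfolding f_def by (rule norm_suminf_le[OF F_le]) simp
  then have "bounded (range f)" by (auto simp: bounded_iff)
  moreover have "f (x n) = e n" for n
  proof -
    have "F m (x n) = 0" if "m \<noteq> n" for m
      using apart[of n m] that by (simp add: F_def dist_commute)
    then have "f (x n) = F n (x n)" unfolding f_def by (subst suminf_finite[of "{n}"]) auto
    then show ?thesis using r[of n] by (simp add: F_def)
  qed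
  moreover have "f z = 0" if "z \<in> S" for z
  proof -
    have "F m z = 0" for m using apart_S[OF that, of m] by (simp add: F_def dist_commute)
    then show ?thesis by (simp add: f_def)
  qed
  ultimately show ?thesis by (auto simp: Ustar_def)
qed

text \<open>
  A Lipschitz function may deviate from \<open>T0\<close> by \<open>c * s\<close> for each fixed \<open>c\<close>, where \<open>s\<close> is the distance to
  the points \<open>y' n\<close>, but not for all \<open>c\<close> simultaneously. Its preimage \<open>g c\<close>, on the other hand, has values at
  \<open>\<psi> (y n)\<close> that tend to 0 as \<open>n\<close> grows, so one can diagonalise over \<open>c\<close> inside \<open>Ustar\<close>.
\<close>

lemma uniform_discrete_codomain:
  fixes T :: "('x::metric_space \<Rightarrow> 'e::banach) \<Rightarrow> ('y::metric_space \<Rightarrow> 'f::real_normed_vector)"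
  assumes E: "\<exists>e::'e. e \<noteq> 0" and F: "\<exists>u::'f. u \<noteq> 0" and Y: "bounded (UNIV :: 'y set)"
    and T: "bij_betw T Ustar Lip"
    and \<psi>: "uniformly_continuous_on UNIV \<psi>" and \<phi>: "continuous_on UNIV \<phi>" and \<phi>\<psi>: "\<And>y. \<phi> (\<psi> y) = y"
    and eq: "\<And>f g y. \<lbrakk>f \<in> Ustar; g \<in> Ustar\<rbrakk> \<Longrightarrow> T f y = T g y \<longleftrightarrow> f (\<psi> y) = g (\<psi> y)"
  shows "uniform_discrete (UNIV :: 'y set)"
proof (rule ccontr)
  assume not_discrete: "\<not> uniform_discrete (UNIV :: 'y set)"
  obtain y y' :: "nat \<Rightarrow> 'y" where d_pos: "\<And>n. 0 < dist (y n) (y' n)"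
    and d_small: "\<And>n. dist (y n) (y' n) < (1/2)^n"
    and apart: "\<And>m n. m \<noteq> n \<Longrightarrow> dist (y n) (y' n) / 2 \<le> dist (y n) (y m)"
    and apart': "\<And>m n. dist (y n) (y' n) / 2 \<le> dist (y n) (y' m)"
    using non_uniform_discrete_pairs[OF not_discrete] by blast
  interpret U: fun_space "Ustar :: ('x \<Rightarrow> 'e) set" by (rule fun_space_Ustar[OF E])
  interpret L: fun_space "Lip :: ('y \<Rightarrow> 'f) set" by (rule fun_space_Lip[OF F Y])
  obtain u :: 'f where u: "norm u = 1" using F by (metis norm_sgn)
  have "\<exists>r>0. \<forall>z. dist (y n) (y' n) / 2 \<le> dist (y n) z \<longrightarrow> r \<le> dist (\<psi> (y n)) (\<psi> z)" for n
  proof -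
    obtain r where "r > 0" "\<And>x. dist x (\<psi> (y n)) < r \<Longrightarrow> dist (\<phi> x) (\<phi> (\<psi> (y n))) < dist (y n) (y' n) / 2"
      using \<phi> d_pos[of n] unfolding continuous_on_iff by (metis UNIV_I half_gt_zero)
    then show ?thesis using \<phi>\<psi> by (metis dist_commute not_less)
  qed
  then obtain r where r: "\<And>n. r n > 0"
    "\<And>n z. dist (y n) (y' n) / 2 \<le> dist (y n) z \<Longrightarrow> r n \<le> dist (\<psi> (y n)) (\<psi> z)" by metis
  define T0 where "T0 = T (\<lambda>_. 0)"
  have T_in: "T f \<in> Lip" if "f \<in> Ustar" for f using T that by (auto simp: bij_betw_def)
  have T_onto: "\<exists>f\<in>Ustar. T f = q" if "q \<in> Lip" for q
  proof -
    have "q \<in> T ` Ustar" using T that by (simp add: bij_betw_def)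
    then show ?thesis by (auto simp: image_iff)
  qed
  define s where "s z = infdist z (range y')" for z
  have s_lip: "1-lipschitz_on UNIV s"
    by (rule lipschitz_onI) (auto simp: s_def dist_real_def infdist_triangle_abs)
  then have "bounded (range s)" using Y Lip_bounded[of s] unfolding Lip_def by blast
  then have "\<exists>g\<in>Ustar. T g = (\<lambda>z. T0 z + s z *\<^sub>R (real c *\<^sub>R u))" for c
    unfolding T0_def by (intro T_onto L.add_scalar[OF T_in[OF U.zero] s_lip])
  then obtain g where g: "\<And>c. g c \<in> Ustar" "\<And>c. T (g c) = (\<lambda>z. T0 z + s z *\<^sub>R (real c *\<^sub>R u))" by metis
  have s0: "s (y' n) = 0" for n by (simp add: s_def)
  have s_ge: "dist (y n) (y' n) / 2 \<le> s (y n)" for n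
  proof -
    have "range y' \<noteq> {}" by blast
    then show ?thesis unfolding s_def infdist_notempty[OF \<open>range y' \<noteq> {}\<close>]
      using apart' by (intro cINF_greatest) auto
  qed
  have g0: "g c (\<psi> (y' n)) = 0" for c n
    using eq[OF g(1) U.zero, of c "y' n"] by (simp add: g(2) s0 T0_def)
  have "\<exists>N. \<forall>n\<ge>N. norm (g c (\<psi> (y n))) \<le> (1/2)^c" for c
  proof -
    have pos: "(0::real) < (1/2)^c" by simp
    obtain d' where d': "d' > 0" "\<And>x x'. dist x x' < d' \<Longrightarrow> dist (g c x) (g c x') < (1/2)^c"
      using uniformly_continuous_dist[OF U.ucont[OF g(1)[of c]] pos] by metis
    obtain d where d: "d > 0" "\<And>z z'. dist z z' < d \<Longrightarrow> dist (\<psi> z) (\<psi> z') < d'"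
      using uniformly_continuous_dist[OF \<psi> d'(1)] by metis
    obtain N where N: "(1/2::real)^N < d" using real_arch_pow_inv[OF d(1), of "1/2"] by auto
    have "norm (g c (\<psi> (y n))) \<le> (1/2)^c" if "n \<ge> N" for n
    proof -
      have "(1/2::real)^n \<le> (1/2)^N" using that by (intro power_decreasing) auto
      then have "dist (y n) (y' n) < d" using d_small[of n] N by linarith
      then have "dist (g c (\<psi> (y n))) (g c (\<psi> (y' n))) < (1/2)^c" by (intro d'(2) d(2))
      then show ?thesis by (simp add: g0)
    qed
    then show ?thesis by blast
  qed
  then obtain N where N: "\<And>c n. N c \<le> n \<Longrightarrow> norm (g c (\<psi> (y n))) \<le> (1/2)^c" by metis
  \<comment> \<open>A strictly increasing sequence with \<open>N c \<le> k c\<close>; distinct \<open>c\<close> use distinct points.\<close>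
  define k where "k c = c + (\<Sum>i\<le>c. N i)" for c
  have "strict_mono k" unfolding strict_mono_Suc_iff by (simp add: k_def)
  then have k_inj: "k m \<noteq> k n" if "m \<noteq> n" for m n
    using that by (metis strict_mono_eq)
  have k_ge: "N c \<le> k c" for c
    using member_le_sum[of c "{..c}" N] by (simp add: k_def)
  obtain f where f: "f \<in> Ustar" "\<And>c. f (\<psi> (y (k c))) = g c (\<psi> (y (k c)))" "\<And>n. f (\<psi> (y' n)) = 0"
  proof -
    have "\<exists>f\<in>Ustar. (\<forall>c. f (\<psi> (y (k c))) = g c (\<psi> (y (k c)))) \<and> (\<forall>z\<in>range (\<lambda>n. \<psi> (y' n)). f z = 0)"
    proof (rule Ustar_interpolation[OF E, of "\<lambda>c. r (k c)"])
      show "r (k c) > 0" for c by (rule r(1))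
      show "r (k c) \<le> dist (\<psi> (y (k c))) (\<psi> (y (k b)))" if "b \<noteq> c" for b c
        by (intro r(2) apart k_inj that)
      show "r (k c) \<le> dist (\<psi> (y (k c))) z" if "z \<in> range (\<lambda>n. \<psi> (y' n))" for c z
        using that r(2)[OF apart'] by blast
      show "norm (g c (\<psi> (y (k c)))) \<le> (1/2)^c" for c by (rule N[OF k_ge])
    qed
    then show ?thesis using that by auto
  qed
  obtain K where K: "K-lipschitz_on UNIV (T f)" using T_in[OF f(1)] by (auto simp: Lip_def)
  obtain K0 where K0: "K0-lipschitz_on UNIV T0" using T_in[OF U.zero] by (auto simp: Lip_def T0_def)
  have "real c / 2 \<le> K + K0" for c
  proof -
    let ?y = "y (k c)" and ?y' = "y' (k c)"
    have 1: "T f ?y = T0 ?y + s ?y *\<^sub>R (real c *\<^sub>R u)"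
      using eq[OF f(1) g(1), of ?y c] f(2) by (simp add: g(2))
    have 2: "T f ?y' = T0 ?y'"
      using eq[OF f(1) U.zero, of ?y'] f(3) by (simp add: T0_def)
    have "(dist ?y ?y' / 2) * real c \<le> s ?y * real c" by (rule mult_right_mono[OF s_ge]) simp
    also have "\<dots> = dist (T f ?y) (T0 ?y)"
      using u infdist_nonneg[of ?y "range y'"] by (simp add: 1 dist_norm s_def)
    also have "\<dots> \<le> dist (T f ?y) (T f ?y') + dist (T0 ?y') (T0 ?y)"
      using dist_triangle[of "T f ?y" "T0 ?y" "T f ?y'"] by (simp add: 2)
    also have "\<dots> \<le> K * dist ?y ?y' + K0 * dist ?y ?y'"
      using lipschitz_onD[OF K, of ?y ?y'] lipschitz_onD[OF K0, of ?y' ?y] by (simp add: dist_commute)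
    finally have "dist ?y ?y' * (real c / 2) \<le> dist ?y ?y' * (K + K0)" by (simp add: algebra_simps)
    then show ?thesis using d_pos[of "k c"] by (simp only: mult_le_cancel_left_pos)
  qed
  then have "real c \<le> 2 * (K + K0)" for c
    by (simp add: field_simps)
  then show False using reals_Archimedean2[of "2 * (K + K0)"] by (simp add: not_less[symmetric])
qed

section \<open>Boundedness of the fibre maps and the characterisation\<close>

lemma Ustar_uniform_discrete:
  assumes "uniform_discrete (UNIV :: 'a::metric_space set)"
  shows "(Ustar :: ('a \<Rightarrow> 'b::real_normed_vector) set) = {f. bounded (range f)}"
proof -
  have "uniformly_continuous_on UNIV f" for f :: "'a \<Rightarrow> 'b"
    using assms unfolding uniform_discrete_def uniformly_continuous_on_def by (metis dist_self)
  then show ?thesis by (auto simp: Ustar_def)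
qed

lemma Lip_uniform_discrete:
  assumes "uniform_discrete (UNIV :: 'a::metric_space set)" "bounded (UNIV :: 'a set)"
  shows "(Lip :: ('a \<Rightarrow> 'b::real_normed_vector) set) = {f. bounded (range f)}"
proof -
  obtain d where d: "d > 0" "\<And>x y::'a. x \<noteq> y \<Longrightarrow> d \<le> dist x y"
    using assms(1) unfolding uniform_discrete_def by (metis UNIV_I not_less)
  have "f \<in> Lip" if f: "bounded (range f)" for f :: "'a \<Rightarrow> 'b"
  proof -
    obtain M where M: "M > 0" "\<And>x y. dist (f x) (f y) \<le> M"
    proof -
      obtain M where "\<And>x y. dist (f x) (f y) \<le> M" using f unfolding bounded_two_points by blast
      then show ?thesis by (intro that[of "max M 1"]) (auto intro: le_max_iff_disj[THEN iffD2])
    qed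
    have "(M / d)-lipschitz_on UNIV f"
    proof (rule lipschitz_onI)
      fix x y
      show "dist (f x) (f y) \<le> M / d * dist x y"
      proof (cases "x = y")
        case False
        have "dist (f x) (f y) \<le> M / d * d" using M(2)[of x y] d(1) by simp
        also have "\<dots> \<le> M / d * dist x y" using M(1) d(1) d(2)[OF False] by (intro mult_left_mono) auto
        finally show ?thesis .
      qed simp
    qed (use M(1) d(1) in simp)
    then show ?thesis by (auto simp: Lip_def)
  qed
  then show ?thesis using Lip_bounded[OF assms(2)] by blast
qed

text \<open>
  If every selection from \<open>B\<close> has bounded image, then only finitely many fibre maps are
  unbounded on \<open>B\<close>, since an infinite sequence of them would admit a selection that tends to infinity.
  Off these, a selection that almost attains the supremum in each fibre bounds all images at once.
\<close>

lemma bounded_off_finite: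
  fixes \<Phi> :: "'y \<Rightarrow> 'e::metric_space \<Rightarrow> 'f::real_normed_vector"
  assumes sel: "\<And>s. bounded (range s) \<Longrightarrow> bounded (range (\<lambda>y. \<Phi> y (s y)))"
    and B: "bounded B"
  shows "\<exists>Y0. finite Y0 \<and> bounded (\<Union>y\<in>UNIV - Y0. \<Phi> y ` B)"
proof (cases "B = {}")
  case False
  then obtain b where b: "b \<in> B" by blast
  define Y0 where "Y0 = {y. \<not> bounded (\<Phi> y ` B)}"
  have bound: "\<exists>M. \<forall>y. norm (\<Phi> y (s y)) \<le> M" if "\<And>y. s y \<in> B" for s
    using sel[of s] bounded_subset[OF B] that by (auto simp: bounded_iff image_subset_iff)
  have "finite Y0"
  proof (rule ccontr)
    assume "infinite Y0"
    then obtain h :: "nat \<Rightarrow> 'y" where h: "inj h" "range h \<subseteq> Y0" using infinite_countable_subset by blast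
    have "\<exists>e\<in>B. norm (\<Phi> (h n) e) > real n" for n
      using h(2) unfolding Y0_def bounded_iff by (fastforce simp: not_le)
    then obtain e where e: "\<And>n. e n \<in> B" "\<And>n. norm (\<Phi> (h n) (e n)) > real n" by metis
    define s where "s y = (if y \<in> range h then e (inv h y) else b)" for y
    have sh: "s (h n) = e n" for n using h(1) by (simp add: s_def)
    have "s y \<in> B" for y using e(1) b by (simp add: s_def)
    then obtain M where M: "\<And>y. norm (\<Phi> y (s y)) \<le> M" using bound by blast
    obtain n where "M < real n" using reals_Archimedean2 by blast
    then show False using M[of "h n"] e(2)[of n] by (simp add: sh)
  qed
  have "\<exists>e\<in>B. y \<notin> Y0 \<longrightarrow> (\<forall>e'\<in>B. norm (\<Phi> y e') \<le> norm (\<Phi> y e) + 1)" for y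
  proof (cases "y \<in> Y0")
    case False
    then have bdd: "bdd_above ((\<lambda>e. norm (\<Phi> y e)) ` B)"
      by (auto simp: Y0_def bounded_iff bdd_above_def)
    have "(SUP e\<in>B. norm (\<Phi> y e)) - 1 < (SUP e\<in>B. norm (\<Phi> y e))" by simp
    then obtain e where "e \<in> B" "(SUP e\<in>B. norm (\<Phi> y e)) - 1 < norm (\<Phi> y e)"
      using less_cSUP_iff[OF \<open>B \<noteq> {}\<close> bdd] by blast
    then show ?thesis using cSUP_upper[OF _ bdd] by (intro bexI[of _ e]) force+
  qed (use b in blast)
  then obtain s where s: "\<And>y. s y \<in> B"
    "\<And>y e. y \<notin> Y0 \<Longrightarrow> e \<in> B \<Longrightarrow> norm (\<Phi> y e) \<le> norm (\<Phi> y (s y)) + 1" by metis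
  obtain M where M: "\<And>y. norm (\<Phi> y (s y)) \<le> M" using bound s(1) by blast
  have "norm (\<Phi> y e) \<le> M + 1" if "y \<notin> Y0" "e \<in> B" for y e
    using s(2)[OF that] M[of y] by linarith
  then have "bounded (\<Union>y\<in>UNIV - Y0. \<Phi> y ` B)" unfolding bounded_iff by blast
  then show ?thesis using \<open>finite Y0\<close> by blast
qed auto

text \<open>
  \<open>\<Phi> y\<close> evaluates the images of the constant functions at \<open>y\<close>. Condition (b) is \<open>bounded_off_finite\<close>
  applied to the maps \<open>\<Phi> y\<close> for \<open>B1\<close> and to their inverses for \<open>B2\<close>.
\<close>

lemma representation_if_biseparating:
  fixes T :: "('x::complete_space \<Rightarrow> 'e::banach) \<Rightarrow> ('y::complete_space \<Rightarrow> 'f::real_normed_vector)"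
  assumes E_nontrivial: "\<exists>e::'e. e \<noteq> 0"
    and F_nontrivial: "\<exists>u::'f. u \<noteq> 0"
    and Y_bounded: "bounded (UNIV :: 'y set)"
    and T_maps: "T \<in> Ustar \<rightarrow> Lip"
    and bisep: "biseparating Ustar Lip T"
  shows "(uniform_discrete (UNIV :: 'x set) \<and> uniform_discrete (UNIV :: 'y set)) \<and>
    (\<exists>(\<psi> :: 'y \<Rightarrow> 'x) (\<Phi> :: 'y \<Rightarrow> 'e \<Rightarrow> 'f).
      bij \<psi> \<and> (\<forall>y. bij (\<Phi> y)) \<and>
      (\<forall>f\<in>Ustar. \<forall>y. T f y = \<Phi> y (f (\<psi> y))) \<and>
      (\<forall>B1 B2. bounded B1 \<and> bounded B2 \<longrightarrow>
        (\<exists>Y0 B3. finite Y0 \<and> bounded B3 \<and>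
          bounded (\<Union>y\<in>UNIV - Y0. \<Phi> y ` B1) \<and>
          B2 \<subseteq> (\<Inter>y\<in>UNIV - Y0. \<Phi> y ` B3))))"
proof -
  interpret U: fun_space "Ustar :: ('x \<Rightarrow> 'e) set" by (rule fun_space_Ustar[OF E_nontrivial])
  interpret L: fun_space "Lip :: ('y \<Rightarrow> 'f) set" by (rule fun_space_Lip[OF F_nontrivial Y_bounded])
  have T: "bij_betw T Ustar Lip" using bisep by (simp add: biseparating_def)
  have T_onto: "\<exists>f\<in>Ustar. T f = q" if "q \<in> Lip" for q
  proof -
    have "q \<in> T ` Ustar" using T that by (simp add: bij_betw_def)
    then show ?thesis by (auto simp: image_iff)
  qed
  obtain \<psi> \<phi> where \<psi>: "uniformly_continuous_on UNIV \<psi>" and \<phi>: "uniformly_continuous_on UNIV \<phi>"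
    and inv: "\<And>x. \<psi> (\<phi> x) = x" "\<And>y. \<phi> (\<psi> y) = y"
    and eq: "\<And>f g y. \<lbrakk>f \<in> Ustar; g \<in> Ustar\<rbrakk> \<Longrightarrow> T f y = T g y \<longleftrightarrow> f (\<psi> y) = g (\<psi> y)"
    using biseparating_homeomorphism[OF U.fun_space_axioms L.fun_space_axioms bisep] by blast
  have Y: "uniform_discrete (UNIV :: 'y set)"
    by (rule uniform_discrete_codomain[OF E_nontrivial F_nontrivial Y_bounded T \<psi> _ inv(2) eq])
      (rule uniformly_continuous_imp_continuous[OF \<phi>])
  have X: "uniform_discrete (UNIV :: 'x set)"
  proof -
    obtain e where e: "e > 0" "\<And>y y' :: 'y. dist y y' < e \<Longrightarrow> y = y'"
      using Y by (auto simp: uniform_discrete_def)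
    obtain d where "d > 0" "\<And>x x'. dist x x' < d \<Longrightarrow> dist (\<phi> x) (\<phi> x') < e"
      using uniformly_continuous_dist[OF \<phi> e(1)] by metis
    then show ?thesis using e(2) inv(1) unfolding uniform_discrete_def by metis
  qed
  note U_eq = Ustar_uniform_discrete[OF X, where 'b = 'e]
  note L_eq = Lip_uniform_discrete[OF Y Y_bounded, where 'b = 'f]
  define \<Phi> where "\<Phi> y e = T (\<lambda>_. e) y" for y e
  have rep: "T f y = \<Phi> y (f (\<psi> y))" if "f \<in> Ustar" for f y
    unfolding \<Phi>_def using eq[OF that U.const] by simp
  have \<Phi>_bij: "bij (\<Phi> y)" for y
  proof (rule bijI)
    show "inj (\<Phi> y)" using eq[OF U.const U.const] by (auto simp: inj_on_def \<Phi>_def)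
    have "v \<in> range (\<Phi> y)" for v
    proof -
      obtain f where "f \<in> Ustar" "T f = (\<lambda>_. v)" using T_onto[OF L.const[of v]] by blast
      then have "v = \<Phi> y (f (\<psi> y))" using rep[of f y] by simp
      then show ?thesis by blast
    qed
    then show "surj (\<Phi> y)" by blast
  qed
  have fwd: "bounded (range (\<lambda>y. \<Phi> y (s y)))" if s: "bounded (range s)" for s
  proof -
    have "bounded (range (\<lambda>x. s (\<phi> x)))" by (rule bounded_subset[OF s]) blast
    then have in_U: "(\<lambda>x. s (\<phi> x)) \<in> Ustar" by (simp add: U_eq)
    have "T (\<lambda>x. s (\<phi> x)) \<in> Lip" and "T (\<lambda>x. s (\<phi> x)) = (\<lambda>y. \<Phi> y (s y))"
      using T_maps in_U by (blast, simp add: rep[OF in_U] inv(2) fun_eq_iff)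
    then show ?thesis by (simp add: L_eq)
  qed
  have bwd: "bounded (range (\<lambda>y. inv_into UNIV (\<Phi> y) (s y)))" if s: "bounded (range s)" for s
  proof -
    have "s \<in> Lip" using s by (simp add: L_eq)
    then obtain f where f: "f \<in> Ustar" "T f = s" using T_onto by blast
    have "inv_into UNIV (\<Phi> y) (s y) = f (\<psi> y)" for y
      using rep[OF f(1), of y] f(2) \<Phi>_bij[of y] by (metis bij_is_inj inv_f_f)
    then have "range (\<lambda>y. inv_into UNIV (\<Phi> y) (s y)) \<subseteq> range f" by auto
    then show ?thesis by (rule bounded_subset[OF U.bdd[OF f(1)]])
  qed
  have "\<exists>Y0 B3. finite Y0 \<and> bounded B3 \<and> bounded (\<Union>y\<in>UNIV - Y0. \<Phi> y ` B1) \<and>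
      B2 \<subseteq> (\<Inter>y\<in>UNIV - Y0. \<Phi> y ` B3)" if B: "bounded B1" "bounded B2" for B1 B2
  proof -
    obtain Y1 where Y1: "finite Y1" "bounded (\<Union>y\<in>UNIV - Y1. \<Phi> y ` B1)"
      using bounded_off_finite[of \<Phi>, OF fwd B(1)] by blast
    obtain Y2 where Y2: "finite Y2" "bounded (\<Union>y\<in>UNIV - Y2. inv_into UNIV (\<Phi> y) ` B2)"
      using bounded_off_finite[of "\<lambda>y. inv_into UNIV (\<Phi> y)", OF bwd B(2)] by blast
    let ?B3 = "\<Union>y\<in>UNIV - Y2. inv_into UNIV (\<Phi> y) ` B2"
    have "b \<in> \<Phi> y ` ?B3" if "b \<in> B2" "y \<notin> Y2" for b y
    proof (rule image_eqI)
      show "b = \<Phi> y (inv_into UNIV (\<Phi> y) b)" using bij_is_surj[OF \<Phi>_bij[of y]] by (simp add: surj_f_inv_f)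
      show "inv_into UNIV (\<Phi> y) b \<in> ?B3" using that by blast
    qed
    then have "B2 \<subseteq> (\<Inter>y\<in>UNIV - (Y1 \<union> Y2). \<Phi> y ` ?B3)" by blast
    moreover have "bounded (\<Union>y\<in>UNIV - (Y1 \<union> Y2). \<Phi> y ` B1)"
      by (rule bounded_subset[OF Y1(2)]) blast
    moreover have "finite (Y1 \<union> Y2)" using Y1(1) Y2(1) by simp
    ultimately show ?thesis using Y2(2)
      by (intro exI[of _ "Y1 \<union> Y2"] exI[of _ ?B3] conjI)
  qed
  moreover have "bij \<psi>" by (rule o_bij[of \<phi>]) (auto simp: inv fun_eq_iff)
  ultimately show ?thesis
    by (intro conjI X Y exI[of _ \<psi>] exI[of _ \<Phi>]) (simp_all add: \<Phi>_bij rep)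
qed

text \<open>
  Only surjectivity needs an argument: the pointwise preimage of \<open>g\<close> is bounded off
  a finite set by the hypothesis on \<open>\<Phi>\<close> applied to the range of \<open>g\<close>, and hence is bounded.
\<close>

lemma biseparating_if_representation:
  fixes T :: "('x::metric_space \<Rightarrow> 'e::real_normed_vector) \<Rightarrow> ('y::metric_space \<Rightarrow> 'f::real_normed_vector)"
  assumes Y_bounded: "bounded (UNIV :: 'y set)" and T_maps: "T \<in> Ustar \<rightarrow> Lip"
    and X: "uniform_discrete (UNIV :: 'x set)"
    and \<psi>: "bij \<psi>" and \<Phi>: "\<forall>y. bij (\<Phi> y)"
    and rep: "\<forall>f\<in>Ustar. \<forall>y. T f y = \<Phi> y (f (\<psi> y))"
    and lift: "\<forall>B2. bounded B2 \<longrightarrow> (\<exists>Y0 B3. finite Y0 \<and> bounded B3 \<and>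
      B2 \<subseteq> (\<Inter>y\<in>UNIV - Y0. \<Phi> y ` B3))"
  shows "biseparating Ustar Lip T"
proof -
  note U_eq = Ustar_uniform_discrete[OF X, where 'b = 'e]
  have eq: "T f y = T g y \<longleftrightarrow> f (\<psi> y) = g (\<psi> y)" if "f \<in> Ustar" "g \<in> Ustar" for f g y
    using rep that \<Phi> by (simp add: inj_eq bij_is_inj)
  have onto: "(\<forall>y. P (\<psi> y)) \<longleftrightarrow> (\<forall>x. P x)" for P
  proof
    assume P: "\<forall>y. P (\<psi> y)"
    show "\<forall>x. P x"
    proof
      fix x
      obtain y where "x = \<psi> y" using surjD[OF bij_is_surj[OF \<psi>]] by blast
      then show "P x" using P by simp
    qed
  qed simp
  have "inj_on T Ustar"
  proof (rule inj_onI)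
    fix f g assume fg: "f \<in> Ustar" "g \<in> Ustar" "T f = T g"
    then have "\<forall>y. f (\<psi> y) = g (\<psi> y)" using eq[OF fg(1,2)] by simp
    then show "f = g" using onto[of "\<lambda>x. f x = g x"] by auto
  qed
  moreover have "T ` Ustar = Lip"
  proof
    show "T ` Ustar \<subseteq> Lip" using T_maps by auto
    show "Lip \<subseteq> T ` Ustar"
    proof
      fix g :: "'y \<Rightarrow> 'f" assume "g \<in> Lip"
      then have "bounded (range g)" by (rule Lip_bounded[OF Y_bounded])
      then obtain Y0 B3 where Y0: "finite Y0" and B3: "bounded B3"
        and sub: "range g \<subseteq> (\<Inter>y\<in>UNIV - Y0. \<Phi> y ` B3)" 
        using lift[rule_format, OF \<open>bounded (range g)\<close>] by (elim exE conjE) (rule that)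
      define f where "f x = inv_into UNIV (\<Phi> (inv_into UNIV \<psi> x)) (g (inv_into UNIV \<psi> x))" for x
      have f_\<psi>: "f (\<psi> y) = inv_into UNIV (\<Phi> y) (g y)" for y
        using bij_is_inj[OF \<psi>] by (simp add: f_def)
      have "f (\<psi> y) \<in> B3 \<union> f ` \<psi> ` Y0" for y
      proof (cases "y \<in> Y0")
        case False
        then have "g y \<in> \<Phi> y ` B3" using sub by blast
        then obtain e where "e \<in> B3" "g y = \<Phi> y e" by blast
        then show ?thesis using bij_is_inj[OF spec[OF \<Phi>, of y]] by (simp add: f_\<psi>)
      qed blast
      then have "range f \<subseteq> B3 \<union> f ` \<psi> ` Y0" using onto[of "\<lambda>x. f x \<in> B3 \<union> f ` \<psi> ` Y0"] by blast
      moreover have "bounded (B3 \<union> f ` \<psi> ` Y0)" using B3 Y0 by (simp add: finite_imp_bounded)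
      ultimately have "bounded (range f)" by (rule bounded_subset[rotated])
      then have f: "f \<in> Ustar" by (simp add: U_eq)
      have "T f y = g y" for y
        using rep f bij_is_surj[OF spec[OF \<Phi>, of y]] by (simp add: f_\<psi> surj_f_inv_f)
      then have "T f = g" by (rule ext)
      then show "g \<in> T ` Ustar" using f by blast
    qed
  qed
  moreover have "perp h f g \<longleftrightarrow> perp (T h) (T f) (T g)" if "f \<in> Ustar" "g \<in> Ustar" "h \<in> Ustar" for f g h
    unfolding perp_pointwise eq[OF that(1,3)] eq[OF that(2,3)]
    using onto[of "\<lambda>x. f x = h x \<or> g x = h x"] by (rule sym)
  ultimately show ?thesis by (auto simp: biseparating_def bij_betw_def)
qed

theorem theorem9p3:
  fixes T :: "('x::complete_space \<Rightarrow> 'e::banach) \<Rightarrow> ('y::complete_space \<Rightarrow> 'f::banach)"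
  assumes E_nontrivial: "\<exists>e::'e. e \<noteq> 0"
    and F_nontrivial: "\<exists>u::'f. u \<noteq> 0"
    and Y_bounded: "bounded (UNIV :: 'y set)"
    and T_maps: "T \<in> Ustar \<rightarrow> Lip"
  shows "biseparating Ustar Lip T \<longleftrightarrow>
    (uniform_discrete (UNIV :: 'x set) \<and> uniform_discrete (UNIV :: 'y set)) \<and>
    (\<exists>(\<psi> :: 'y \<Rightarrow> 'x) (\<Phi> :: 'y \<Rightarrow> 'e \<Rightarrow> 'f).
      bij \<psi> \<and> (\<forall>y. bij (\<Phi> y)) \<and>
      (\<forall>f\<in>Ustar. \<forall>y. T f y = \<Phi> y (f (\<psi> y))) \<and>
      (\<forall>B1 B2. bounded B1 \<and> bounded B2 \<longrightarrow>
        (\<exists>Y0 B3. finite Y0 \<and> bounded B3 \<and>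
          bounded (\<Union>y\<in>UNIV - Y0. \<Phi> y ` B1) \<and>
          B2 \<subseteq> (\<Inter>y\<in>UNIV - Y0. \<Phi> y ` B3))))"
proof (rule iffI, goal_cases)
  case 1
  then show ?case by (rule representation_if_biseparating[OF assms])
next
  case 2
  then show ?case
  proof (elim conjE exE, goal_cases)
    case (1 \<psi> \<Phi>)
    have "\<exists>Y0 B3. finite Y0 \<and> bounded B3 \<and> B2 \<subseteq> (\<Inter>y\<in>UNIV - Y0. \<Phi> y ` B3)"
      if "bounded B2" for B2
      using 1(6)[rule_format, of "{}" B2] that by auto
    then show ?case
      by (intro biseparating_if_representation[OF Y_bounded T_maps 1(1,3-5)]) simp
  qed
qed

end
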